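(* Fix $p\in[1,\infty)$ and $q_0,q_1,r_0,r_1\in[1,\infty]$ with $q_0\le q_1$, $q_0\le r_0$, $q_1\le r_1$. Let $\mathfrak X$ be an arbitrary metric measure space and assume $\mathcal M^{\rm c}_{\mathfrak X}$ is bounded from $L^{p,q_i}(\mathfrak X)$ to $L^{p,r_i}(\mathfrak X)$ for $i\in\{0,1\}$. Then for each $\theta\in(0,1)$, $\mathcal M^{\rm c}_{\mathfrak X}$ is bounded from $L^{p,q_\theta}(\mathfrak X)$ to $L^{p,r_\theta}(\mathfrak X)$, where $\frac1{q_\theta}=\frac{1-\theta}{q_0}+\frac\theta{q_1}$ and $\frac1{r_\theta}=\frac{1-\theta}{r_0}+\frac\theta{r_1}$ (with $1/\infty=0$).
   Context: Metric measure space $(X,\rho,\mu)$: nonempty set, metric, nonnegative Borel measure. $\mathcal M^{\rm c}_{\mathfrak X}f(x)=\sup_{s>0}\mu(B(x,s))^{-1}\int_{B(x,s)}|f|d\mu$ over open balls, balls of measure $0$ or $\infty$ omitted. Lorentz quasinorm: $d_f(t)=\mu(\{|f|>t\})$, $\|f\|_{p,q}=p^{1/q}(\int_0^\infty(t d_f(t)^{1/p})^q dt/t)^{1/q}$ for $q<\infty$, $\|f\|_{p,\infty}=\sup_{t>0}t d_f(t)^{1/p}$; $L^{p,q}(\mathfrak X)$ the corresponding space. *)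

theory Defs
  imports "HOL-Analysis.Analysis"
begin

definition epowr :: "ennreal \<Rightarrow> real \<Rightarrow> ennreal" where
  "epowr x a = (if x = \<infinity> then \<infinity> else ennreal (enn2real x powr a))"

text \<open>Centered Hardy--Littlewood maximal function over open balls; balls of
  measure 0 or \<infinity> are omitted (supremum over the empty set is 0).\<close>
definition maxfun_c :: "'a::metric_space measure \<Rightarrow> ('a \<Rightarrow> real) \<Rightarrow> 'a \<Rightarrow> ennreal" where
  "maxfun_c M f x =
     (SUP s \<in> {s::real. 0 < s \<and> emeasure M (ball x s) \<noteq> 0 \<and> emeasure M (ball x s) \<noteq> \<infinity>}.
        (\<integral>\<^sup>+ y \<in> ball x s. ennreal \<bar>f y\<bar> \<partial>M) / emeasure M (ball x s))"

text \<open>Distribution function of a nonnegative function (outer measure is used so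
  that it makes sense also for sets that are not known to be measurable).\<close>
definition distrib_fun :: "'a measure \<Rightarrow> ('a \<Rightarrow> ennreal) \<Rightarrow> real \<Rightarrow> ennreal" where
  "distrib_fun M g t = outer_measure_of M {x \<in> space M. g x > ennreal t}"

definition lorentz_norm :: "'a measure \<Rightarrow> real \<Rightarrow> ennreal \<Rightarrow> ('a \<Rightarrow> ennreal) \<Rightarrow> ennreal" where
  "lorentz_norm M p q g =
     (if q = \<infinity> then (SUP t \<in> {0<..}. ennreal t * epowr (distrib_fun M g t) (1/p))
      else ennreal (p powr (1 / enn2real q)) *
        epowr (\<integral>\<^sup>+ t \<in> {0<..}. epowr (ennreal t * epowr (distrib_fun M g t) (1/p)) (enn2real q)
                   / ennreal t \<partial>lborel) (1 / enn2real q))"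

definition maxfun_bounded :: "'a::metric_space measure \<Rightarrow> real \<Rightarrow> ennreal \<Rightarrow> ennreal \<Rightarrow> bool" where
  "maxfun_bounded M p q r \<longleftrightarrow>
     (\<exists>C::real. C \<ge> 0 \<and>
        (\<forall>f \<in> borel_measurable M.
           lorentz_norm M p q (\<lambda>x. ennreal \<bar>f x\<bar>) < \<infinity> \<longrightarrow>
           lorentz_norm M p r (maxfun_c M f) \<le> ennreal C * lorentz_norm M p q (\<lambda>x. ennreal \<bar>f x\<bar>)))"

end

theory Submission
  imports Defs
begin

text \<open>
  Since \<open>p\<close> is fixed, the \<open>L(p,q)\<close> quasinorm of \<open>g\<close> is equivalent to the \<open>\<ell>\<^sup>q\<close> norm of the sequence
  \<open>2\<^sup>k d\<^sub>g(2\<^sup>k)^(1/p)\<close>, \<open>k \<in> \<int>\<close>, so the claim is a Marcinkiewicz interpolation theorem for sequences.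
  Restricting \<open>f\<close> to a set \<open>K\<close> of dyadic levels of \<open>\<bar>f\<bar>\<close> restricts its sequence to \<open>K\<close>, up to a constant.
  For each output level \<open>2\<^sup>i\<close> we cut \<open>f\<close> along the set of those \<open>k\<close> at which its sequence (not \<open>\<bar>f\<bar>\<close> itself)
  exceeds \<open>2\<^sup>\<gamma>\<^sup>i\<close>, bound the number of large terms of the sequence of the maximal function by Chebyshev's
  inequality at both endpoints, and sum geometric series over \<open>i\<close>.
  If \<open>r\<^sub>1 \<le> r\<^sub>0\<close> or \<open>q\<^sub>0 = q\<^sub>1\<close>, the embedding \<open>\<ell>\<^sup>q \<subseteq> \<ell>\<^sup>r\<close> for \<open>q \<le> r\<close> suffices.
\<close>

section \<open>Powers of extended nonnegative reals\<close>

lemma ennreal_inverse_antimono: "x \<le> y \<Longrightarrow> inverse y \<le> inverse (x :: ennreal)"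
proof (cases "x = 0")
  case False
  assume "x \<le> y"
  with False show ?thesis
    by (cases x; cases y) (auto simp: inverse_ennreal top_unique intro!: ennreal_leI)
qed simp

lemma ennreal_inverse_inverse [simp]: "inverse (inverse x) = (x :: ennreal)"
proof (cases "x = 0")
  case False
  then show ?thesis by (cases x) (auto simp: inverse_ennreal)
qed simp

lemma epowr_top [simp]: "epowr \<infinity> a = \<infinity>" "epowr top a = top"
  by (auto simp: epowr_def)

lemma epowr_ennreal: "0 \<le> x \<Longrightarrow> epowr (ennreal x) a = ennreal (x powr a)"
  by (simp add: epowr_def)

lemma epowr_0 [simp]: "epowr 0 a = 0"
  by (simp add: epowr_def)

lemma epowr_1 [simp]: "epowr x 1 = x"
  by (cases x) (auto simp: epowr_ennreal)

lemma epowr_mono: "x \<le> y \<Longrightarrow> 0 \<le> a \<Longrightarrow> epowr x a \<le> epowr y a"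
  by (cases x; cases y) (auto simp: epowr_ennreal powr_mono2 top_unique)

lemma epowr_mult: "0 < a \<Longrightarrow> epowr (x * y) a = epowr x a * epowr y a"
  by (cases x; cases y)
    (auto simp: epowr_ennreal powr_mult ennreal_mult[symmetric] ennreal_mult_top ennreal_top_mult
      split: if_splits)

lemma epowr_epowr: "epowr (epowr x a) b = epowr x (a * b)"
  by (cases x) (auto simp: epowr_ennreal powr_powr)

lemma epowr_epowr_inverse: "0 < a \<Longrightarrow> epowr (epowr x a) (1 / a) = x"
  "0 < a \<Longrightarrow> epowr (epowr x (1 / a)) a = x"
  by (simp_all add: epowr_epowr)

lemma epowr_mult_add: "epowr x a * epowr x b = epowr x (a + b)"
  by (cases x) (auto simp: epowr_ennreal powr_add ennreal_mult[symmetric] ennreal_top_mult)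

lemma epowr_le_iff: "0 < a \<Longrightarrow> epowr x a \<le> y \<longleftrightarrow> x \<le> epowr y (1 / a)"
  using epowr_mono[of x "epowr y (1/a)" a] epowr_mono[of "epowr x a" y "1/a"]
  by (auto simp: epowr_epowr_inverse)

text \<open>After division by \<open>x + y\<close> the claim concerns two numbers in [0,1] with sum
  1, and such a number is at most its \<open>a\<close>-th power because
  \<open>a \<le> 1\<close>.\<close>

lemma powr_add_le:
  fixes x y a :: real
  assumes "0 \<le> x" "0 \<le> y" "0 < a" "a \<le> 1"
  shows "(x + y) powr a \<le> x powr a + y powr a"
proof (cases "x + y = 0")
  case False
  then have pos: "x + y > 0" using assms by auto
  have le: "u / (x + y) \<le> (u / (x + y)) powr a" if "0 \<le> u" "u \<le> x + y" for u
    using that pos assms powr_mono'[of a 1 "u / (x+y)"] by (cases "u = 0") auto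
  have "1 = x / (x + y) + y / (x + y)" using pos by (simp add: add_divide_distrib[symmetric])
  also have "\<dots> \<le> (x / (x + y)) powr a + (y / (x + y)) powr a"
    using le[of x] le[of y] assms by auto
  also have "\<dots> = (x powr a + y powr a) / (x + y) powr a"
    using assms pos by (simp add: powr_divide add_divide_distrib)
  finally show ?thesis using pos by (simp add: field_simps)
qed (use assms in auto)

lemma epowr_add_le: "0 < a \<Longrightarrow> a \<le> 1 \<Longrightarrow> epowr (x + y) a \<le> epowr x a + epowr y a"
  by (cases x; cases y)
    (auto simp: epowr_ennreal powr_add_le ennreal_plus[symmetric] simp del: ennreal_plus)

lemma epowr_le_self: "x \<le> 1 \<Longrightarrow> 1 \<le> a \<Longrightarrow> epowr x a \<le> x"
  using powr_mono'[of 1 a "enn2real x"] by (cases x) (auto simp: epowr_ennreal top_unique ennreal_leI)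

section \<open>Sequence norms\<close>

abbreviation esum :: "('i \<Rightarrow> ennreal) \<Rightarrow> ennreal" where
  "esum f \<equiv> (\<integral>\<^sup>+k. f k \<partial>count_space UNIV)"

lemma esum_swap:
  fixes f :: "'i::countable \<Rightarrow> 'j \<Rightarrow> ennreal"
  shows "esum (\<lambda>j. esum (\<lambda>i. f i j)) = esum (\<lambda>i. esum (\<lambda>j. f i j))"
  by (rule nn_integral_count_space_nn_integral) auto

lemma le_esum: "f k \<le> esum f"
  by (rule nn_integral_ge_point) simp

lemma esum_bij: "bij g \<Longrightarrow> esum (\<lambda>k. f (g k)) = esum f"
  by (rule nn_integral_bij_count_space)

text \<open>The admissible \<open>i\<close> are those up to some \<open>m\<close>, so the sum is a
  geometric series running downwards from \<open>m\<close> with ratio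
  \<open>2 powr - (\<gamma> * \<beta>)\<close>, and its first term is at most
  \<open>x powr \<beta>\<close>.\<close>

lemma geometric_sum_below:
  fixes x \<gamma> \<beta> :: real
  assumes "0 < x" "0 < \<gamma>" "0 < \<beta>"
  shows "esum (\<lambda>i::int. if 2 powr (\<gamma> * i) \<le> x then ennreal ((2 powr (\<gamma> * i)) powr \<beta>) else 0)
    \<le> ennreal (x powr \<beta> / (1 - 2 powr - (\<gamma> * \<beta>)))"
proof -
  define m where "m = \<lfloor>log 2 x / \<gamma>\<rfloor>"
  define c where "c = (2::real) powr - (\<gamma> * \<beta>)"
  have c: "0 < c" "c < 1" using assms by (auto simp: c_def powr_less_one)
  have iff: "2 powr (\<gamma> * i) \<le> x \<longleftrightarrow> i \<le> m" for i :: int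
    using assms by (simp add: m_def le_floor_iff pos_le_divide_eq powr_le_iff mult.commute)
  have "esum (\<lambda>i::int. if 2 powr (\<gamma> * i) \<le> x then ennreal ((2 powr (\<gamma> * i)) powr \<beta>) else 0)
    = (\<integral>\<^sup>+i. ennreal (2 powr (\<gamma> * \<beta> * i)) * indicator {..m} i \<partial>count_space UNIV)"
    by (intro nn_integral_cong) (simp add: iff powr_powr mult_ac split: split_indicator)
  also have "\<dots> = (\<integral>\<^sup>+i. ennreal (2 powr (\<gamma> * \<beta> * i)) \<partial>count_space {..m})"
    by (simp add: nn_integral_count_space_indicator)
  also have "\<dots> = (\<integral>\<^sup>+n. ennreal (2 powr (\<gamma> * \<beta> * (m - int n))) \<partial>count_space UNIV)"
  proof -
    have "bij_betw (\<lambda>n. m - int n) UNIV {..m}"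
      by (rule bij_betwI[where g = "\<lambda>i. nat (m - i)"]) auto
    from nn_integral_bij_count_space[OF this, of "\<lambda>i. ennreal (2 powr (\<gamma> * \<beta> * i))"]
    show ?thesis by simp
  qed
  also have "\<dots> = (\<Sum>n. ennreal (2 powr (\<gamma> * \<beta> * m) * c ^ n))"
    unfolding nn_integral_count_space_nat
  proof (rule arg_cong[where f = suminf], rule ext)
    fix n :: nat
    have "c ^ n = c powr real n" using c by (simp add: powr_realpow)
    then have "c ^ n = 2 powr (- (\<gamma> * \<beta>) * real n)" by (simp add: c_def powr_powr)
    then show "ennreal (2 powr (\<gamma> * \<beta> * (m - int n))) = ennreal (2 powr (\<gamma> * \<beta> * m) * c ^ n)"
      by (simp add: powr_add[symmetric] algebra_simps)
  qed
  also have "\<dots> = ennreal (2 powr (\<gamma> * \<beta> * m) / (1 - c))"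
    using c by (subst suminf_ennreal2)
      (auto intro!: summable_mult summable_geometric simp: suminf_mult summable_geometric suminf_geometric)
  also have "\<dots> \<le> ennreal (x powr \<beta> / (1 - c))"
  proof -
    have "2 powr (\<gamma> * \<beta> * m) = (2 powr (\<gamma> * m)) powr \<beta>" by (simp add: powr_powr mult_ac)
    also have "\<dots> \<le> x powr \<beta>" using iff[of m] assms by (intro powr_mono2) auto
    finally show ?thesis using c by (intro ennreal_leI divide_right_mono) auto
  qed
  finally show ?thesis by (simp add: c_def)
qed

text \<open>Reflecting \<open>i\<close> to \<open>- i\<close> and replacing \<open>x\<close> by its
  inverse turns this into \<open>geometric_sum_below\<close>.\<close>

lemma geometric_sum_above:
  fixes x \<gamma> \<beta> :: real
  assumes "0 < x" "0 < \<gamma>" "0 < \<beta>"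
  shows "esum (\<lambda>i::int. if x \<le> 2 powr (\<gamma> * i) then ennreal ((2 powr (\<gamma> * i)) powr - \<beta>) else 0)
    \<le> ennreal (x powr - \<beta> / (1 - 2 powr - (\<gamma> * \<beta>)))"
proof -
  have "esum (\<lambda>i::int. if x \<le> 2 powr (\<gamma> * i) then ennreal ((2 powr (\<gamma> * i)) powr - \<beta>) else 0)
    = esum (\<lambda>i::int. if x \<le> 2 powr (\<gamma> * (- real_of_int i)) then ennreal ((2 powr (\<gamma> * (- real_of_int i))) powr - \<beta>) else 0)"
    by (rule esum_bij[symmetric, of uminus, THEN trans]) (auto simp: bij_uminus intro!: nn_integral_cong)
  also have "\<dots> = esum (\<lambda>i::int. if 2 powr (\<gamma> * i) \<le> inverse x then ennreal ((2 powr (\<gamma> * i)) powr \<beta>) else 0)"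
  proof (intro nn_integral_cong)
    fix i :: int
    have "2 powr (\<gamma> * (- real_of_int i)) = inverse (2 powr (\<gamma> * i))" by (simp add: powr_minus)
    moreover have "x \<le> inverse (2 powr (\<gamma> * i)) \<longleftrightarrow> 2 powr (\<gamma> * i) \<le> inverse x"
      using assms by (simp add: field_simps)
    moreover have "inverse (2 powr (\<gamma> * i)) powr - \<beta> = (2 powr (\<gamma> * i)) powr \<beta>"
      by (simp add: powr_minus inverse_powr)
    ultimately show "(if x \<le> 2 powr (\<gamma> * (- real_of_int i)) then ennreal ((2 powr (\<gamma> * (- real_of_int i))) powr - \<beta>) else 0)
      = (if 2 powr (\<gamma> * i) \<le> inverse x then ennreal ((2 powr (\<gamma> * i)) powr \<beta>) else 0)"
      by simp
  qed
  also have "\<dots> \<le> ennreal (inverse x powr \<beta> / (1 - 2 powr - (\<gamma> * \<beta>)))"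
    using assms by (intro geometric_sum_below) auto
  finally show ?thesis using assms by (simp add: powr_minus inverse_powr)
qed

section \<open>Sequence quasinorms with values in [0,\<infinity>] and their nesting\<close>

definition lnorm :: "ennreal \<Rightarrow> ('i \<Rightarrow> ennreal) \<Rightarrow> ennreal" where
  "lnorm q a = (if q = \<infinity> then (SUP k. a k)
     else epowr (esum (\<lambda>k. epowr (a k) (enn2real q))) (1 / enn2real q))"

lemma lnorm_top: "lnorm top a = (SUP k. a k)"
  by (simp add: lnorm_def)

lemma lnorm_ennreal: "0 \<le> q \<Longrightarrow> lnorm (ennreal q) a = epowr (esum (\<lambda>k. epowr (a k) q)) (1 / q)"
  by (simp add: lnorm_def)

lemma lnorm_le_iff:
  "0 < q \<Longrightarrow> lnorm (ennreal q) a \<le> c \<longleftrightarrow> esum (\<lambda>k. epowr (a k) q) \<le> epowr c q"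
  by (simp add: lnorm_ennreal epowr_le_iff)

lemma ennreal_exponent_cases:
  assumes "0 < q"
  obtains (fin) u where "q = ennreal u" "0 < u" | (inf) "q = \<infinity>"
  using assms by (cases q) auto

lemma lnorm_cmult:
  assumes "0 < q" shows "lnorm q (\<lambda>k. c * a k) = c * lnorm q a"
  using assms
proof (cases rule: ennreal_exponent_cases)
  case (fin u)
  then show ?thesis
    by (simp add: lnorm_ennreal epowr_mult nn_integral_cmult epowr_epowr_inverse)
qed (simp add: lnorm_top SUP_mult_left_ennreal)

lemma lnorm_bij:
  assumes "bij g" shows "lnorm q (\<lambda>k. a (g k)) = lnorm q a"
proof (cases "q = \<infinity>")
  case True
  have "range (\<lambda>k. a (g k)) = range a" using bij_is_surj[OF assms] by (metis image_image)
  then show ?thesis by (simp add: lnorm_top True)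
next
  case False
  then show ?thesis
    using esum_bij[OF assms, of "\<lambda>k. epowr (a k) (enn2real q)"] by (simp add: lnorm_def)
qed

lemma le_lnorm:
  assumes "0 < q" shows "a k \<le> lnorm q a"
  using assms
proof (cases rule: ennreal_exponent_cases)
  case (fin u)
  have "epowr (epowr (a k) u) (1 / u) \<le> lnorm q a"
    using fin by (auto simp: lnorm_ennreal intro!: epowr_mono le_esum)
  then show ?thesis using fin by (simp add: epowr_epowr_inverse)
qed (auto simp: lnorm_top intro: SUP_upper)

text \<open>Every term is at most the norm \<open>A\<close>. For finite exponents the
  \<open>v\<close>-th power of \<open>a k\<close> is therefore at most its \<open>u\<close>-th power
  times the power \<open>v - u\<close> of \<open>A\<close>, and summation over \<open>k\<close>
  gives the \<open>v\<close>-th power of \<open>A\<close>.\<close>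

lemma lnorm_antimono:
  assumes "0 < q" "q \<le> r" shows "lnorm r a \<le> lnorm q a"
proof (cases "r = \<infinity>")
  case True
  then show ?thesis using le_lnorm[OF assms(1)] by (auto simp: lnorm_top intro!: SUP_least)
next
  case False
  then obtain u v where uv: "q = ennreal u" "r = ennreal v" "0 < u" "u \<le> v"
    using assms by (cases q; cases r) (auto simp: top_unique)
  show ?thesis
  proof (cases "u = v")
    case False
    then have less: "u < v" using uv by simp
    define A where "A = lnorm q a"
    have "epowr (a k) v \<le> epowr (a k) u * epowr A (v - u)" for k
    proof -
      have "epowr (a k) v = epowr (a k) u * epowr (a k) (v - u)"
        by (simp add: epowr_mult_add)
      also have "\<dots> \<le> epowr (a k) u * epowr A (v - u)"
        using le_lnorm[OF assms(1)] less by (auto intro!: mult_left_mono epowr_mono simp: A_def)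
      finally show ?thesis .
    qed
    then have "esum (\<lambda>k. epowr (a k) v) \<le> esum (\<lambda>k. epowr (a k) u * epowr A (v - u))"
      by (intro nn_integral_mono)
    also have "\<dots> = esum (\<lambda>k. epowr (a k) u) * epowr A (v - u)"
      by (simp add: nn_integral_multc)
    also have "esum (\<lambda>k. epowr (a k) u) = epowr A u"
      using uv by (simp add: A_def lnorm_ennreal epowr_epowr_inverse)
    also have "epowr A u * epowr A (v - u) = epowr A v"
      by (simp add: epowr_mult_add)
    finally show ?thesis using uv less by (simp add: lnorm_le_iff A_def)
  qed (use uv in auto)
qed

section \<open>Marcinkiewicz interpolation for sequences\<close>

text \<open>The sum of indicators counts the indices with value above \<open>l\<close>, possibly
  infinitely many; each of them contributes at least \<open>l powr v\<close> to the right-hand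
  side.\<close>

lemma chebyshev_esum:
  assumes "0 < v" "0 \<le> l"
  shows "ennreal (l powr v) * esum (\<lambda>k. indicator {k. ennreal l < c k} k) \<le> esum (\<lambda>k. epowr (c k) v)"
proof -
  have "ennreal (l powr v) * esum (\<lambda>k. indicator {k. ennreal l < c k} k)
      = esum (\<lambda>k. ennreal (l powr v) * indicator {k. ennreal l < c k} k)"
    by (rule nn_integral_cmult[symmetric]) auto
  also have "\<dots> \<le> esum (\<lambda>k. epowr (c k) v)"
    using assms epowr_mono[of "ennreal l" _ v]
    by (intro nn_integral_mono) (auto simp: epowr_ennreal less_imp_le split: split_indicator)
  finally show ?thesis .
qed

text \<open>The hypothesis \<open>u \<le> v\<close> enters through \<open>y powr (v / u) \<le> y\<close> for \<open>y = (\<Sum>k\<in>K. a k powr u) * t powr (q - u) \<le> 1\<close>.\<close>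
lemma count_above_level:
  fixes a :: "'i \<Rightarrow> real" and l t :: real
  assumes a: "\<And>k. 0 \<le> a k" "esum (\<lambda>k. ennreal (a k powr q)) \<le> 1"
    and uv: "0 < u" "u \<le> v" and pos: "0 < l" "0 < t"
    and K: "\<And>k. k \<in> K \<Longrightarrow> a k powr u * t powr (q - u) \<le> a k powr q"
    and lt: "l powr (r - v) = t powr ((q - u) * (v / u))"
    and c: "lnorm (ennreal v) c \<le> lnorm (ennreal u) (\<lambda>k. ennreal (a k) * indicator K k)"
  shows "ennreal (l powr r) * esum (\<lambda>k. indicator {k. ennreal l < c k} k)
    \<le> esum (\<lambda>k. ennreal (a k powr u * t powr (q - u)) * indicator K k)"
proof -
  define S where "S = esum (\<lambda>k. ennreal (a k powr u) * indicator K k)"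
  have S_eq: "esum (\<lambda>k. epowr (ennreal (a k) * indicator K k) u) = S"
    unfolding S_def using a(1)
    by (intro nn_integral_cong) (auto simp: epowr_ennreal split: split_indicator)
  have St: "S * ennreal (t powr (q - u)) = esum (\<lambda>k. ennreal (a k powr u * t powr (q - u)) * indicator K k)"
    unfolding S_def
    by (subst nn_integral_multc[symmetric]) (auto intro!: nn_integral_cong simp: ennreal_mult mult_ac)
  also have "\<dots> \<le> esum (\<lambda>k. ennreal (a k powr q))"
    using K by (intro nn_integral_mono) (auto split: split_indicator intro!: ennreal_leI)
  finally have le1: "S * ennreal (t powr (q - u)) \<le> 1" using a(2) by simp
  have "esum (\<lambda>k. epowr (c k) v) \<le> epowr (epowr S (1 / u)) v"
    using c uv by (simp add: lnorm_le_iff) (simp add: lnorm_ennreal S_eq)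
  also have "\<dots> = epowr S (v / u)" by (simp add: epowr_epowr)
  finally have cS: "esum (\<lambda>k. epowr (c k) v) \<le> epowr S (v / u)" .
  \<comment> \<open>Chebyshev's inequality supplies the power \<open>v\<close> of \<open>l\<close>;
    by \<open>lt\<close> the remaining factor \<open>l powr (r - v)\<close> is exactly what makes
    the bound the \<open>v / u\<close>-th power of the quantity shown to be at most 1.\<close>
  have "ennreal (l powr r) * esum (\<lambda>k. indicator {k. ennreal l < c k} k)
      = ennreal (l powr (r - v)) * (ennreal (l powr v) * esum (\<lambda>k. indicator {k. ennreal l < c k} k))"
    by (simp add: mult.assoc[symmetric] ennreal_mult[symmetric] powr_add[symmetric])
  also have "\<dots> \<le> ennreal (l powr (r - v)) * epowr S (v / u)"
    using uv pos by (intro mult_left_mono order_trans[OF chebyshev_esum cS]) auto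
  also have "\<dots> = epowr (S * ennreal (t powr (q - u))) (v / u)"
    using uv by (simp add: epowr_mult epowr_ennreal powr_powr lt mult.commute)
  also have "\<dots> \<le> S * ennreal (t powr (q - u))"
    using uv by (intro epowr_le_self le1) auto
  finally show ?thesis by (simp only: St)
qed

text \<open>A discrete layer-cake bound. For finite positive \<open>x\<close> the largest
  \<open>i\<close> with \<open>2 * 2 powr i < x\<close> alone suffices, because then
  \<open>x \<le> 4 * 2 powr i\<close>. The factor 2 in the threshold leaves room for bounding
  \<open>x\<close> by two summands, one of which must exceed \<open>2 powr i\<close>.\<close>

lemma powr_le_dyadic_sum:
  assumes "0 < r"
  shows "epowr x r \<le> ennreal (4 powr r) *
    esum (\<lambda>i::int. ennreal ((2 powr i) powr r) * indicator {i::int. ennreal (2 * 2 powr i) < x} i)"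
    (is "_ \<le> _ * esum ?f")
proof (cases x)
  case (real y)
  show ?thesis
  proof (cases "y = 0")
    case False
    then have y: "0 < y" using real by simp
    define i where "i = \<lceil>log 2 y\<rceil> - 2"
    have "real_of_int i + 1 < log 2 y" "log 2 y \<le> real_of_int i + 2"
      unfolding i_def by linarith+
    then have "2 powr (real_of_int i + 1) < y" "y \<le> 2 powr (real_of_int i + 2)"
      using y by (auto simp: less_log_iff log_le_iff)
    then have i: "2 * 2 powr i < y" "y \<le> 4 * 2 powr i"
      by (auto simp: powr_add mult.commute)
    have "y powr r \<le> (4 * 2 powr i) powr r" using i y assms by (intro powr_mono2) auto
    then have "epowr x r \<le> ennreal (4 powr r) * ?f i"
      using i real y by (simp add: epowr_ennreal powr_mult ennreal_mult[symmetric] ennreal_lessI ennreal_leI)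
    also have "\<dots> \<le> ennreal (4 powr r) * esum ?f"
      by (intro mult_left_mono le_esum) auto
    finally show ?thesis .
  qed (use real in simp)
next
  case top
  \<comment> \<open>Every \<open>i\<close> is counted when \<open>x\<close> is infinite, and the
    terms are unbounded.\<close>
  have "esum ?f = top"
  proof (rule ccontr)
    assume "esum ?f \<noteq> top"
    then obtain z where z: "esum ?f = ennreal z" "0 \<le> z" by (cases "esum ?f") auto
    define i where "i = \<lceil>log 2 (z + 1) / r\<rceil>"
    have "log 2 (z + 1) \<le> i * r"
      using assms by (simp add: i_def pos_divide_le_eq[symmetric])
    then have "z + 1 \<le> (2 powr i) powr r" using z by (simp add: powr_powr log_le_iff)
    moreover have "ennreal ((2 powr i) powr r) \<le> ennreal z"
      using le_esum[of ?f i] top z by (simp add: less_top[symmetric] ennreal_less_top)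
    ultimately show False using z by (simp add: ennreal_le_iff)
  qed
  then show ?thesis using assms by (simp add: ennreal_mult_top)
qed
text \<open>With the sums interchanged, a fixed \<open>k\<close> sees only the levels below
  \<open>a k\<close>. Since \<open>q - u\<close> is positive, they form a geometric series dominated
  by \<open>a k powr (q - u)\<close>, and the factor \<open>a k powr u\<close> restores
  \<open>a k powr q\<close>.\<close>

lemma sum_truncation_above:
  fixes a :: "'i \<Rightarrow> real"
  assumes a: "\<And>k. 0 \<le> a k" and "u < q" "0 < \<gamma>"
  shows "esum (\<lambda>i::int. esum (\<lambda>k. ennreal (a k powr u * (2 powr (\<gamma> * i)) powr (q - u)) *
      indicator {k. 2 powr (\<gamma> * i) < a k} k))
    \<le> ennreal (1 / (1 - 2 powr - (\<gamma> * (q - u)))) * esum (\<lambda>k. ennreal (a k powr q))"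
    (is "_ \<le> ennreal ?C * _")
proof -
  have C: "0 \<le> ?C" using assms by (simp add: powr_less_one less_imp_le mult_pos_pos)
  have "esum (\<lambda>i::int. ennreal (a k powr u * (2 powr (\<gamma> * i)) powr (q - u)) *
      indicator {k. 2 powr (\<gamma> * i) < a k} k) \<le> ennreal ?C * ennreal (a k powr q)" (is "?L \<le> _") for k
  proof (cases "a k = 0")
    case False
    then have ak: "0 < a k" using a[of k] by simp
    have "?L \<le> esum (\<lambda>i::int. ennreal (a k powr u) *
        (if 2 powr (\<gamma> * i) \<le> a k then ennreal ((2 powr (\<gamma> * i)) powr (q - u)) else 0))"
      by (intro nn_integral_mono) (auto simp: ennreal_mult split: split_indicator)
    also have "\<dots> = ennreal (a k powr u) * esum (\<lambda>i::int.
        if 2 powr (\<gamma> * i) \<le> a k then ennreal ((2 powr (\<gamma> * i)) powr (q - u)) else 0)"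
      by (rule nn_integral_cmult) auto
    also have "\<dots> \<le> ennreal (a k powr u) * ennreal (a k powr (q - u) * ?C)"
      using geometric_sum_below[OF ak, of \<gamma> "q - u"] assms by (intro mult_left_mono) auto
    also have "\<dots> = ennreal ?C * ennreal (a k powr q)"
      using C ak by (simp add: ennreal_mult[symmetric] powr_diff)
    finally show ?thesis .
  next
    case True
    then show ?thesis by (simp add: not_less)
  qed
  then have "esum (\<lambda>k. esum (\<lambda>i::int. ennreal (a k powr u * (2 powr (\<gamma> * i)) powr (q - u)) *
      indicator {k. 2 powr (\<gamma> * i) < a k} k)) \<le> esum (\<lambda>k. ennreal ?C * ennreal (a k powr q))"
    by (intro nn_integral_mono)
  then show ?thesis by (simp add: nn_integral_cmult esum_swap[symmetric])
qed

text \<open>The complementary case: a fixed \<open>k\<close> sees only the levels from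
  \<open>a k\<close> upwards, and since \<open>q - u\<close> is negative the series decays in that
  direction, again with a sum of order \<open>a k powr (q - u)\<close>.\<close>

lemma sum_truncation_below:
  fixes a :: "'i \<Rightarrow> real"
  assumes a: "\<And>k. 0 \<le> a k" and "q < u" "0 < \<gamma>"
  shows "esum (\<lambda>i::int. esum (\<lambda>k. ennreal (a k powr u * (2 powr (\<gamma> * i)) powr (q - u)) *
      indicator (- {k. 2 powr (\<gamma> * i) < a k}) k))
    \<le> ennreal (1 / (1 - 2 powr - (\<gamma> * (u - q)))) * esum (\<lambda>k. ennreal (a k powr q))"
    (is "_ \<le> ennreal ?C * _")
proof -
  have C: "0 \<le> ?C" using assms by (simp add: powr_less_one less_imp_le mult_pos_pos)
  have "esum (\<lambda>i::int. ennreal (a k powr u * (2 powr (\<gamma> * i)) powr (q - u)) *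
      indicator (- {k. 2 powr (\<gamma> * i) < a k}) k) \<le> ennreal ?C * ennreal (a k powr q)" (is "?L \<le> _") for k
  proof (cases "a k = 0")
    case False
    then have ak: "0 < a k" using a[of k] by simp
    have "?L \<le> esum (\<lambda>i::int. ennreal (a k powr u) *
        (if a k \<le> 2 powr (\<gamma> * i) then ennreal ((2 powr (\<gamma> * i)) powr - (u - q)) else 0))"
      by (intro nn_integral_mono) (auto simp: ennreal_mult split: split_indicator)
    also have "\<dots> = ennreal (a k powr u) * esum (\<lambda>i::int.
        if a k \<le> 2 powr (\<gamma> * i) then ennreal ((2 powr (\<gamma> * i)) powr - (u - q)) else 0)"
      by (rule nn_integral_cmult) auto
    also have "\<dots> \<le> ennreal (a k powr u) * ennreal (a k powr - (u - q) * ?C)"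
      using geometric_sum_above[OF ak, of \<gamma> "u - q"] assms by (intro mult_left_mono) auto
    also have "\<dots> = ennreal ?C * ennreal (a k powr q)"
      using C ak by (simp add: ennreal_mult[symmetric] powr_diff)
    finally show ?thesis .
  qed simp
  then have "esum (\<lambda>k. esum (\<lambda>i::int. ennreal (a k powr u * (2 powr (\<gamma> * i)) powr (q - u)) *
      indicator (- {k. 2 powr (\<gamma> * i) < a k}) k)) \<le> esum (\<lambda>k. ennreal ?C * ennreal (a k powr q))"
    by (intro nn_integral_mono)
  then show ?thesis by (simp add: nn_integral_cmult esum_swap[symmetric])
qed

text \<open>The input is cut at \<open>2 powr (\<gamma> * i)\<close> for the output level \<open>2 powr i\<close>; the two equations for \<open>\<gamma>\<close> make the
  powers of \<open>2 powr i\<close> cancel at both endpoints. If \<open>q1 = \<infinity>\<close> then \<open>enn2real q1 = 0\<close>, and the absolute value only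
  keeps the (then superfluous) second constant nonnegative.\<close>
lemma marcinkiewicz_normalised:
  fixes a :: "'i \<Rightarrow> real" and b :: "'i \<Rightarrow> ennreal" and q1 r1 :: ennreal
  assumes a: "\<And>k. 0 \<le> a k" "esum (\<lambda>k. ennreal (a k powr q)) \<le> 1"
    and q: "0 < q0" "q0 < q" "ennreal q < q1" and r: "0 < r" "q0 \<le> r0" "q1 \<le> r1" and \<gamma>: "0 < \<gamma>"
    and \<gamma>0: "r - r0 = \<gamma> * (q - q0) * (r0 / q0)"
    and \<gamma>1: "r * enn2real (inverse r1) - 1 = \<gamma> * (q * enn2real (inverse q1) - 1)"
    and split: "\<And>K. \<exists>b1 b2. (\<forall>k. b k \<le> b1 k + b2 k) \<and>
        lnorm (ennreal r0) b1 \<le> lnorm (ennreal q0) (\<lambda>k. ennreal (a k) * indicator K k) \<and>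
        lnorm r1 b2 \<le> lnorm q1 (\<lambda>k. ennreal (a k) * indicator (- K) k)"
  shows "esum (\<lambda>k. epowr (b k) r) \<le> ennreal (4 powr r) *
    (ennreal (1 / (1 - 2 powr - (\<gamma> * (q - q0)))) + ennreal (1 / (1 - 2 powr - (\<gamma> * \<bar>enn2real q1 - q\<bar>))))"
    (is "_ \<le> _ * (ennreal ?C0 + ennreal ?C1)")
proof -
  \<comment> \<open>\<open>l i\<close> is the output level, \<open>t i\<close> the height at which
    the input is cut, and \<open>K i\<close> collects the indices of the large input terms.\<close>
  define l where "l i = (2::real) powr i" for i :: int
  define t where "t i = (2::real) powr (\<gamma> * i)" for i :: int
  define K where "K i = {k. t i < a k}" for i :: int
  have pos: "0 < l i" "0 < t i" for i by (auto simp: l_def t_def)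
  \<comment> \<open>Since \<open>t i\<close> is the power \<gamma> of \<open>l i\<close>, powers of
    the two agree as soon as their exponents have the ratio \<gamma>.\<close>
  have lt: "l i powr e = t i powr e'" if "e = \<gamma> * e'" for i e e'
    using that by (simp add: l_def t_def powr_powr mult_ac)
  have "\<forall>i. \<exists>b1 b2. (\<forall>k. b k \<le> b1 k + b2 k) \<and>
      lnorm (ennreal r0) b1 \<le> lnorm (ennreal q0) (\<lambda>k. ennreal (a k) * indicator (K i) k) \<and>
      lnorm r1 b2 \<le> lnorm q1 (\<lambda>k. ennreal (a k) * indicator (- K i) k)"
    by (intro allI split)
  from choice[OF this] obtain b1 where "\<forall>i. \<exists>b2. (\<forall>k. b k \<le> b1 i k + b2 k) \<and>
      lnorm (ennreal r0) (b1 i) \<le> lnorm (ennreal q0) (\<lambda>k. ennreal (a k) * indicator (K i) k) \<and>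
      lnorm r1 b2 \<le> lnorm q1 (\<lambda>k. ennreal (a k) * indicator (- K i) k)" ..
  from choice[OF this] obtain b2 where b: "\<And>i k. b k \<le> b1 i k + b2 i k"
    "\<And>i. lnorm (ennreal r0) (b1 i) \<le> lnorm (ennreal q0) (\<lambda>k. ennreal (a k) * indicator (K i) k)"
    "\<And>i. lnorm r1 (b2 i) \<le> lnorm q1 (\<lambda>k. ennreal (a k) * indicator (- K i) k)"
    by blast
  \<comment> \<open>The contribution of level \<open>l i\<close> to the dyadic bound for the
    \<open>r\<close>-th power sum.\<close>
  define N where "N c i = ennreal (l i powr r) * esum (\<lambda>k. indicator {k. ennreal (l i) < c i k} k)"
    for c :: "int \<Rightarrow> 'i \<Rightarrow> ennreal" and i

  have "esum (N b1) \<le> esum (\<lambda>i. esum (\<lambda>k. ennreal (a k powr q0 * t i powr (q - q0)) * indicator (K i) k))"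
    unfolding N_def
  proof (intro nn_integral_mono count_above_level[OF a, where v = r0])
    fix i k assume "k \<in> K i"
    then have "t i < a k" by (simp add: K_def)
    then have "a k powr q0 * t i powr (q - q0) \<le> a k powr q0 * a k powr (q - q0)"
      using pos[of i] q by (intro mult_left_mono powr_mono2) auto
    then show "a k powr q0 * t i powr (q - q0) \<le> a k powr q" by (simp add: powr_add[symmetric])
  qed (use q r b pos \<gamma>0 in \<open>auto intro!: lt\<close>)
  also have "\<dots> \<le> ennreal ?C0 * esum (\<lambda>k. ennreal (a k powr q))"
    unfolding K_def t_def using a q \<gamma> by (intro sum_truncation_above) auto
  also have "\<dots> \<le> ennreal ?C0 * 1" using a by (intro mult_left_mono) auto
  finally have N1: "esum (N b1) \<le> ennreal ?C0" by simp

  have N2: "esum (N b2) \<le> ennreal ?C1"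
  proof (cases "r1 = top")
    case False
    \<comment> \<open>\<open>q1 \<le> r1\<close> makes \<open>q1\<close> finite together with
      \<open>r1\<close>.\<close>
    then obtain u v where uv: "q1 = ennreal u" "r1 = ennreal v" "q < u" "u \<le> v" "0 < u"
      using q r by (cases q1; cases r1) (auto simp: top_unique ennreal_less_iff)
    then have "r * (1 / v) - 1 = \<gamma> * (q * (1 / u) - 1)"
      using \<gamma>1 by (simp add: inverse_ennreal divide_simps)
    then have \<gamma>v: "r - v = \<gamma> * ((q - u) * (v / u))" using uv by (simp add: field_simps)
    have "esum (N b2) \<le> esum (\<lambda>i. esum (\<lambda>k. ennreal (a k powr u * t i powr (q - u)) * indicator (- K i) k))"
      unfolding N_def
    proof (intro nn_integral_mono count_above_level[OF a, where v = v])
      \<comment> \<open>Outside \<open>K i\<close> the comparison of \<open>a k\<close> with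
        \<open>t i\<close> is reversed, and so is the sign of \<open>q - u\<close>, so the same
        bound by \<open>a k powr q\<close> results.\<close>
      fix i k assume "k \<in> - K i"
      then have "a k \<le> t i" by (simp add: K_def)
      then have "a k powr u * t i powr (q - u) \<le> a k powr u * a k powr (q - u)" if "0 < a k"
        using that uv by (intro mult_left_mono powr_mono2') auto
      then show "a k powr u * t i powr (q - u) \<le> a k powr q"
        using a(1)[of k] by (cases "a k = 0") (auto simp: powr_add[symmetric])
    qed (use uv b pos \<gamma>v in \<open>auto intro!: lt\<close>)
    also have "\<dots> \<le> ennreal (1 / (1 - 2 powr - (\<gamma> * (u - q)))) * esum (\<lambda>k. ennreal (a k powr q))"
      unfolding K_def t_def using a uv \<gamma> by (intro sum_truncation_below) auto
    also have "\<dots> \<le> ennreal ?C1 * 1" using a uv by (intro mult_mono) auto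
    finally show ?thesis by simp
  next
    case r1: True
    \<comment> \<open>For infinite \<open>r1\<close> counting is replaced by emptiness: the cut
      input has \<open>q1\<close>-norm at most \<open>l i\<close>, hence no term of
      \<open>b2 i\<close> exceeds \<open>l i\<close>, and \<open>N b2\<close> vanishes.\<close>
    have "lnorm q1 (\<lambda>k. ennreal (a k) * indicator (- K i) k) \<le> ennreal (l i)" for i
    proof (cases q1)
      case (real u)
      then have u: "q < u" "0 < u" using q by (auto simp: ennreal_less_iff)
      \<comment> \<open>The left side of \<open>\<gamma>1\<close> is -1 because the inverse of an
        infinite \<open>r1\<close> is 0.\<close>
      then have "- 1 = \<gamma> * (q * (1 / u) - 1)"
        using \<gamma>1 real r1 by (simp add: inverse_ennreal divide_simps)
      then have "u = \<gamma> * (u - q)" using u by (simp add: field_simps)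
      then have lu: "l i powr u = t i powr (u - q)" by (rule lt)
      have "epowr (ennreal (a k) * indicator (- K i) k) u \<le> ennreal (a k powr q) * ennreal (l i powr u)" for k
      proof -
        have "a k powr u \<le> a k powr q * t i powr (u - q)" if "a k \<le> t i"
        proof -
          have "a k powr u = a k powr q * a k powr (u - q)" by (simp add: powr_add[symmetric])
          also have "\<dots> \<le> a k powr q * t i powr (u - q)"
            using that a(1) u by (intro mult_left_mono powr_mono2) auto
          finally show ?thesis .
        qed
        then show ?thesis
          using a(1)[of k]
          by (auto simp: K_def lu not_less epowr_ennreal ennreal_mult[symmetric] ennreal_leI split: split_indicator)
      qed
      then have "esum (\<lambda>k. epowr (ennreal (a k) * indicator (- K i) k) u)
          \<le> esum (\<lambda>k. ennreal (a k powr q) * ennreal (l i powr u))"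
        by (intro nn_integral_mono)
      also have "\<dots> = esum (\<lambda>k. ennreal (a k powr q)) * ennreal (l i powr u)"
        by (rule nn_integral_multc) auto
      also have "\<dots> \<le> 1 * ennreal (l i powr u)" using a(2) by (intro mult_right_mono) auto
      finally show ?thesis using u real pos[of i] by (simp add: lnorm_le_iff epowr_ennreal)
    next
      case top
      \<comment> \<open>Both inverses are 0, so \<open>\<gamma>1\<close> says that \<gamma> is 1,
        and the cut itself bounds the remaining terms by \<open>l i\<close>.\<close>
      then have "t i = l i" using \<gamma>1 r1 by (simp add: t_def l_def)
      then show ?thesis
        using top by (auto simp: lnorm_top K_def not_less ennreal_leI intro!: SUP_least split: split_indicator)
    qed
    then have "b2 i k \<le> ennreal (l i)" for i k
      using b(3)[of i] r1 by (auto simp: lnorm_top SUP_le_iff intro: order_trans)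
    then have "{k. ennreal (l i) < b2 i k} = {}" for i by (auto simp: not_less)
    then show ?thesis by (simp add: N_def)
  qed

  have "esum (\<lambda>k. epowr (b k) r) \<le> esum (\<lambda>k. ennreal (4 powr r) *
      esum (\<lambda>i. ennreal (l i powr r) * indicator {i. ennreal (2 * l i) < b k} i))"
    using powr_le_dyadic_sum[OF r(1)] unfolding l_def by (intro nn_integral_mono) auto
  also have "\<dots> = ennreal (4 powr r) * esum (\<lambda>k.
      esum (\<lambda>i. ennreal (l i powr r) * indicator {i. ennreal (2 * l i) < b k} i))"
    by (rule nn_integral_cmult) auto
  also have "\<dots> = ennreal (4 powr r) * esum (\<lambda>i.
      esum (\<lambda>k. ennreal (l i powr r) * indicator {i. ennreal (2 * l i) < b k} i))"
    by (simp only: esum_swap)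
  also have "\<dots> \<le> ennreal (4 powr r) * esum (\<lambda>i. N b1 i + N b2 i)"
  proof (intro mult_left_mono nn_integral_mono)
    fix i :: int
    have "indicator {i. ennreal (2 * l i) < b k} i \<le>
        (indicator {k. ennreal (l i) < b1 i k} k + indicator {k. ennreal (l i) < b2 i k} k :: ennreal)" for k
    proof -
      have "b k \<le> ennreal (2 * l i)" if "b1 i k \<le> ennreal (l i)" "b2 i k \<le> ennreal (l i)"
      proof -
        have "b k \<le> ennreal (l i) + ennreal (l i)" using b(1)[of k i] that by (meson add_mono order_trans)
        then show ?thesis using pos[of i] by (simp add: ennreal_plus[symmetric] del: ennreal_plus)
      qed
      then show ?thesis by (auto simp: not_less not_le split: split_indicator)
    qed
    then have "esum (\<lambda>k. ennreal (l i powr r) * indicator {i. ennreal (2 * l i) < b k} i) \<le>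
        esum (\<lambda>k. ennreal (l i powr r) * (indicator {k. ennreal (l i) < b1 i k} k + indicator {k. ennreal (l i) < b2 i k} k))"
      by (intro nn_integral_mono mult_left_mono) auto
    also have "\<dots> = N b1 i + N b2 i"
      by (simp add: N_def nn_integral_cmult nn_integral_add distrib_left)
    finally show "esum (\<lambda>k. ennreal (l i powr r) * indicator {i. ennreal (2 * l i) < b k} i) \<le> N b1 i + N b2 i" .
  qed auto
  also have "\<dots> = ennreal (4 powr r) * (esum (N b1) + esum (N b2))"
    by (simp add: nn_integral_add)
  also have "\<dots> \<le> ennreal (4 powr r) * (ennreal ?C0 + ennreal ?C1)"
    using N1 N2 by (intro mult_left_mono add_mono) auto
  finally show ?thesis .
qed

text \<open>By homogeneity the normalised case applies to \<open>a\<close> divided by its norm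
  \<open>A\<close> and \<open>b\<close> divided by \<open>c * A\<close>. The constant
  \<open>C\<close> is chosen before the sequences, so that one constant serves all functions; the
  pieces may depend on \<open>K\<close>, since they will come from the operator applied to two parts
  of \<open>f\<close>.\<close>

lemma marcinkiewicz_lnorm:
  fixes q1 r1 :: ennreal and c :: real
  assumes c: "0 < c"
    and q: "0 < q0" "q0 < q" "ennreal q < q1" and r: "0 < r" "q0 \<le> r0" "q1 \<le> r1" and \<gamma>: "0 < \<gamma>"
    and \<gamma>0: "r - r0 = \<gamma> * (q - q0) * (r0 / q0)"
    and \<gamma>1: "r * enn2real (inverse r1) - 1 = \<gamma> * (q * enn2real (inverse q1) - 1)"
  shows "\<exists>C>0. \<forall>(a::'i \<Rightarrow> ennreal) (b::'i \<Rightarrow> ennreal). (\<forall>K. \<exists>b1 b2. (\<forall>k. b k \<le> b1 k + b2 k) \<and>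
        lnorm (ennreal r0) b1 \<le> ennreal c * lnorm (ennreal q0) (\<lambda>k. a k * indicator K k) \<and>
        lnorm r1 b2 \<le> ennreal c * lnorm q1 (\<lambda>k. a k * indicator (- K) k))
      \<longrightarrow> lnorm (ennreal r) b \<le> ennreal C * lnorm (ennreal q) a"
proof -
  define D where "D = 4 powr r *
    (1 / (1 - 2 powr - (\<gamma> * (q - q0))) + \<bar>1 / (1 - 2 powr - (\<gamma> * \<bar>enn2real q1 - q\<bar>))\<bar>)"
  have D: "0 < D" using \<gamma> q by (auto simp: D_def powr_less_one intro!: mult_pos_pos add_pos_nonneg)
  have q1_pos: "0 < q1" "0 < r1" using q r by (auto intro: less_le_trans le_less_trans[OF zero_le])
  have "lnorm (ennreal r) b \<le> ennreal (c * D powr (1 / r)) * lnorm (ennreal q) a"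
    if split: "\<And>K. \<exists>b1 b2. (\<forall>k. b k \<le> b1 k + b2 k) \<and>
        lnorm (ennreal r0) b1 \<le> ennreal c * lnorm (ennreal q0) (\<lambda>k. a k * indicator K k) \<and>
        lnorm r1 b2 \<le> ennreal c * lnorm q1 (\<lambda>k. a k * indicator (- K) k)" for a b :: "'i \<Rightarrow> ennreal"
  proof -
    have ak: "a k \<le> lnorm (ennreal q) a" for k using q by (intro le_lnorm) auto
    consider "lnorm (ennreal q) a = 0" | "lnorm (ennreal q) a = top"
      | A where "lnorm (ennreal q) a = ennreal A" "0 < A"
      by (cases "lnorm (ennreal q) a") (auto simp: less_le)
    then show ?thesis
    proof cases
      case 1
      then have a0: "a k = 0" for k using ak[of k] by simp
      \<comment> \<open>As \<open>a\<close> vanishes, the two pieces for any one \<open>K\<close>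
        vanish, and with them \<open>b\<close>.\<close>
      obtain b1 b2 where b: "\<And>k. b k \<le> b1 k + b2 k"
        "lnorm (ennreal r0) b1 \<le> ennreal c * lnorm (ennreal q0) (\<lambda>k. a k * indicator UNIV k)"
        "lnorm r1 b2 \<le> ennreal c * lnorm q1 (\<lambda>k. a k * indicator (- UNIV) k)"
        using split[of UNIV] by blast
      have "lnorm q' (\<lambda>k::'i. 0) = 0" if "0 < q'" for q'
        using lnorm_cmult[OF that, of 0 "\<lambda>k. 0"] by simp
      then have "lnorm (ennreal r0) b1 = 0" "lnorm r1 b2 = 0"
        using b(2,3) q q1_pos by (auto simp: a0)
      then have "b1 k = 0" "b2 k = 0" for k
        using le_lnorm[of "ennreal r0" b1 k] le_lnorm[of r1 b2 k] q r q1_pos by auto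
      then have "b k = 0" for k using b(1)[of k] by simp
      then show ?thesis using r by (simp add: lnorm_ennreal)
    next
      case 2
      \<comment> \<open>The constant is positive, so the right-hand side is infinite.\<close>
      then show ?thesis using c D by (simp add: ennreal_mult_top)
    next
      case 3
      have fin: "a k < top" for k using ak[of k] 3 by (simp add: le_less_trans)
      \<comment> \<open>Passing to reals loses nothing: by \<open>fin\<close> every term is
        finite.\<close>
      define a' where "a' k = enn2real (a k) / A" for k
      define b' where "b' k = ennreal (1 / (c * A)) * b k" for k
      have a': "ennreal (a' k) = ennreal (1 / A) * a k" for k
        using fin[of k] 3 by (cases "a k") (auto simp: a'_def ennreal_mult[symmetric])
      have pos: "0 \<le> a' k" for k using 3 by (simp add: a'_def)
      have "esum (\<lambda>k. epowr (b' k) r) \<le> ennreal (4 powr r) *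
        (ennreal (1 / (1 - 2 powr - (\<gamma> * (q - q0)))) + ennreal (1 / (1 - 2 powr - (\<gamma> * \<bar>enn2real q1 - q\<bar>))))"
      proof (rule marcinkiewicz_normalised[OF pos _ q r \<gamma> \<gamma>0 \<gamma>1])
        have "lnorm (ennreal q) (\<lambda>k. ennreal (a' k)) = ennreal (1 / A) * ennreal A"
          using q 3 by (simp add: a' lnorm_cmult)
        also have "\<dots> = 1" using 3 by (simp add: ennreal_mult[symmetric])
        finally show "esum (\<lambda>k. ennreal (a' k powr q)) \<le> 1"
          using q pos lnorm_le_iff[of q "\<lambda>k. ennreal (a' k)" 1]
          by (simp add: epowr_ennreal[of 1, simplified] epowr_ennreal)
      next
        fix K
        obtain b1 b2 where b: "\<And>k. b k \<le> b1 k + b2 k"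
          "lnorm (ennreal r0) b1 \<le> ennreal c * lnorm (ennreal q0) (\<lambda>k. a k * indicator K k)"
          "lnorm r1 b2 \<le> ennreal c * lnorm q1 (\<lambda>k. a k * indicator (- K) k)"
          using split[of K] by blast
        have scale: "lnorm r' (\<lambda>k. ennreal (1 / (c * A)) * b0 k) \<le> lnorm q' (\<lambda>k. ennreal (a' k) * indicator K' k)"
          if "0 < r'" "0 < q'" "lnorm r' b0 \<le> ennreal c * lnorm q' (\<lambda>k. a k * indicator K' k)" for r' q' b0 K'
        proof -
          have "lnorm r' (\<lambda>k. ennreal (1 / (c * A)) * b0 k) \<le>
              ennreal (1 / (c * A)) * (ennreal c * lnorm q' (\<lambda>k. a k * indicator K' k))"
            using that by (auto simp: lnorm_cmult intro!: mult_left_mono)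
          also have "\<dots> = ennreal (1 / A) * lnorm q' (\<lambda>k. a k * indicator K' k)"
            using c 3 by (simp add: mult.assoc[symmetric] ennreal_mult[symmetric])
          also have "\<dots> = lnorm q' (\<lambda>k. ennreal (a' k) * indicator K' k)"
            using that by (simp add: a' mult.assoc lnorm_cmult)
          finally show ?thesis .
        qed
        show "\<exists>b1 b2. (\<forall>k. b' k \<le> b1 k + b2 k) \<and>
          lnorm (ennreal r0) b1 \<le> lnorm (ennreal q0) (\<lambda>k. ennreal (a' k) * indicator K k) \<and>
          lnorm r1 b2 \<le> lnorm q1 (\<lambda>k. ennreal (a' k) * indicator (- K) k)"
          using b q r q1_pos
          by (intro exI[of _ "\<lambda>k. ennreal (1 / (c * A)) * b1 k"] exI[of _ "\<lambda>k. ennreal (1 / (c * A)) * b2 k"] conjI allI scale)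
            (auto simp: b'_def distrib_left[symmetric] intro!: mult_left_mono)
      qed
      also have "\<dots> \<le> ennreal D"
      proof -
        have "0 \<le> 1 / (1 - 2 powr - (\<gamma> * (q - q0)))" using \<gamma> q by (simp add: powr_less_one less_imp_le)
        then have "ennreal D = ennreal (4 powr r) * (ennreal (1 / (1 - 2 powr - (\<gamma> * (q - q0)))) +
            ennreal \<bar>1 / (1 - 2 powr - (\<gamma> * \<bar>enn2real q1 - q\<bar>))\<bar>)"
          unfolding D_def by (subst ennreal_mult) (auto simp del: abs_divide)
        then show ?thesis by (auto intro!: mult_left_mono add_left_mono ennreal_leI simp del: abs_divide)
      qed
      also have "\<dots> = epowr (ennreal (D powr (1 / r))) r"
        using D r by (simp add: epowr_ennreal powr_powr)
      finally have "lnorm (ennreal r) b' \<le> ennreal (D powr (1 / r))"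
        using r by (simp add: lnorm_le_iff)
      moreover have "lnorm (ennreal r) b = ennreal (c * A) * lnorm (ennreal r) b'"
        unfolding b'_def[abs_def]
        using c 3 r by (simp add: lnorm_cmult mult.assoc[symmetric] ennreal_mult[symmetric])
      ultimately have "lnorm (ennreal r) b \<le> ennreal (c * A) * ennreal (D powr (1 / r))"
        by (auto intro: mult_left_mono)
      also have "\<dots> = ennreal (c * D powr (1 / r)) * lnorm (ennreal q) a"
        using c 3 by (simp add: ennreal_mult[symmetric] mult_ac)
      finally show ?thesis .
    qed
  qed
  note bound = this
  show ?thesis
  proof (intro exI conjI allI impI)
    show "0 < c * D powr (1 / r)" using c D by simp
  next
    fix a b :: "'i \<Rightarrow> ennreal"
    assume "\<forall>K. \<exists>b1 b2. (\<forall>k. b k \<le> b1 k + b2 k) \<and>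
      lnorm (ennreal r0) b1 \<le> ennreal c * lnorm (ennreal q0) (\<lambda>k. a k * indicator K k) \<and>
      lnorm r1 b2 \<le> ennreal c * lnorm q1 (\<lambda>k. a k * indicator (- K) k)"
    then show "lnorm (ennreal r) b \<le> ennreal (c * D powr (1 / r)) * lnorm (ennreal q) a"
      by - (rule bound, erule spec)
  qed
qed

section \<open>Lorentz norms and dyadic profiles\<close>

definition dyadic_profile :: "'a measure \<Rightarrow> real \<Rightarrow> ('a \<Rightarrow> ennreal) \<Rightarrow> int \<Rightarrow> ennreal" where
  "dyadic_profile M p g k = ennreal (2 powr k) * epowr (distrib_fun M g (2 powr k)) (1 / p)"

text \<open>For positive \<open>y\<close> this is the \<open>k\<close> with
  \<open>2 powr k < y\<close> and \<open>y \<le> 2 powr (k + 1)\<close>; the open lower end matches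
  the strict inequality in the distribution function.\<close>

definition dyadic_level :: "real \<Rightarrow> int" where
  "dyadic_level y = \<lceil>log 2 y\<rceil> - 1"

lemma dyadic_level_iff:
  assumes "0 < y" shows "dyadic_level y = k \<longleftrightarrow> 2 powr k < y \<and> y \<le> 2 powr (real_of_int k + 1)"
proof -
  have "dyadic_level y = k \<longleftrightarrow> real_of_int k < log 2 y \<and> log 2 y \<le> real_of_int k + 1"
    unfolding dyadic_level_def by linarith
  then show ?thesis using assms by (simp add: less_log_iff log_le_iff)
qed

lemma distrib_fun_antimono: "s \<le> t \<Longrightarrow> distrib_fun M g t \<le> distrib_fun M g s"
  unfolding distrib_fun_def
  by (intro outer_measure_of_mono) (auto intro: le_less_trans ennreal_leI)

text \<open>The step with index \<open>k\<close> lives on an interval of length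
  \<open>2 powr k\<close>; countability of the index set allows the interchange of sum and
  integral.\<close>

lemma nn_integral_dyadic_step:
  "(\<integral>\<^sup>+t. esum (\<lambda>k::int. c k * indicator {2 powr k<..2 powr (real_of_int k + 1)} t) \<partial>lborel) =
    esum (\<lambda>k. c k * ennreal (2 powr k))"
proof -
  have "(\<integral>\<^sup>+t. esum (\<lambda>k::int. c k * indicator {2 powr k<..2 powr (real_of_int k + 1)} t) \<partial>lborel) =
    esum (\<lambda>k::int. \<integral>\<^sup>+t. c k * indicator {2 powr k<..2 powr (real_of_int k + 1)} t \<partial>lborel)"
    by (rule nn_integral_count_space_nn_integral) auto
  also have "\<dots> = esum (\<lambda>k. c k * ennreal (2 powr k))"
    by (intro nn_integral_cong) (simp add: nn_integral_cmult powr_add)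
  finally show ?thesis .
qed

text \<open>The half-open dyadic intervals partition the positive half-line, so a single term
  survives.\<close>

lemma dyadic_step_eq:
  assumes "0 < t"
  shows "esum (\<lambda>k::int. c k * indicator {2 powr k<..2 powr (real_of_int k + 1)} t) = c (dyadic_level t)"
proof -
  have "(indicator {2 powr k<..2 powr (real_of_int k + 1)} t :: ennreal) = (if k = dyadic_level t then 1 else 0)" for k :: int
    using dyadic_level_iff[OF assms, of k] by (auto split: split_indicator)
  then show ?thesis
    by (subst nn_integral_count_space'[where A = "{dyadic_level t}"]) auto
qed

section \<open>Comparison of the Lorentz integrand with its dyadic samples\<close>

context
  fixes M :: "'a measure" and p :: real and g :: "'a \<Rightarrow> ennreal" and h :: "real \<Rightarrow> ennreal"
  assumes p: "0 < p"
  defines "h \<equiv> \<lambda>t. ennreal t * epowr (distrib_fun M g t) (1 / p)"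
begin

text \<open>On its dyadic interval \<open>t\<close> is at most twice the left end, and the antitone
  distribution function is at most its value there.\<close>

lemma dyadic_profile_upper:
  assumes "0 < t" shows "h t \<le> 2 * dyadic_profile M p g (dyadic_level t)"
proof -
  define k where "k = dyadic_level t"
  have k: "2 powr k < t" "t \<le> 2 * 2 powr k"
    using dyadic_level_iff[OF assms, of k] by (auto simp: k_def powr_add mult.commute)
  have "h t \<le> ennreal (2 * 2 powr k) * epowr (distrib_fun M g (2 powr k)) (1 / p)"
    unfolding h_def using k p
    by (intro mult_mono epowr_mono distrib_fun_antimono ennreal_leI) auto
  then show ?thesis by (simp add: dyadic_profile_def k_def ennreal_mult mult.assoc)
qed

text \<open>The distribution function is bounded below by its value at the right end, but
  \<open>t\<close> only by the left end; hence the shifted index and the factor 1/2.\<close>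

lemma dyadic_profile_lower:
  assumes "0 < t" shows "ennreal (1 / 2) * dyadic_profile M p g (dyadic_level t + 1) \<le> h t"
proof -
  define k where "k = dyadic_level t"
  have k: "2 powr k < t" "t \<le> 2 powr (real_of_int k + 1)"
    using dyadic_level_iff[OF assms, of k] by (auto simp: k_def)
  have "ennreal (1 / 2) * dyadic_profile M p g (k + 1) =
      ennreal (2 powr k) * epowr (distrib_fun M g (2 powr (real_of_int k + 1))) (1 / p)"
    unfolding dyadic_profile_def mult.assoc[symmetric]
    by (subst ennreal_mult[symmetric]) (auto simp: powr_add)
  also have "\<dots> \<le> h t"
    unfolding h_def using k p
    by (intro mult_mono epowr_mono distrib_fun_antimono ennreal_leI) auto
  finally show ?thesis by (simp add: k_def)
qed

text \<open>\<open>c\<close> defines a step function above the integrand, with \<open>1 / t\<close>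
  replaced by its value at the left end. The interval length cancels this denominator, and only the
  factor 2 of \<open>dyadic_profile_upper\<close>, raised to \<open>u\<close>, remains.\<close>

lemma lorentz_integral_upper:
  assumes u: "0 < u"
  shows "(\<integral>\<^sup>+ t \<in> {0<..}. epowr (h t) u / ennreal t \<partial>lborel)
    \<le> ennreal (2 powr u) * esum (\<lambda>k. epowr (dyadic_profile M p g k) u)"
proof -
  define c where "c k = epowr (2 * dyadic_profile M p g k) u / ennreal (2 powr k)" for k :: int
  have "(\<integral>\<^sup>+ t \<in> {0<..}. epowr (h t) u / ennreal t \<partial>lborel) \<le>
    (\<integral>\<^sup>+t. esum (\<lambda>k::int. c k * indicator {2 powr k<..2 powr (real_of_int k + 1)} t) \<partial>lborel)"
  proof (intro nn_integral_mono)
    fix t :: real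
    have "epowr (h t) u / ennreal t \<le> c (dyadic_level t)" if t: "0 < t"
    proof -
      have "ennreal (2 powr dyadic_level t) \<le> ennreal t"
        using dyadic_level_iff[OF t, of "dyadic_level t"] by (intro ennreal_leI) auto
      then show ?thesis
        unfolding c_def divide_ennreal_def using u t dyadic_profile_upper[OF t]
        by (intro mult_mono epowr_mono) (auto simp: ennreal_inverse_antimono)
    qed
    then show "epowr (h t) u / ennreal t * indicator {0<..} t
        \<le> esum (\<lambda>k::int. c k * indicator {2 powr k<..2 powr (real_of_int k + 1)} t)"
      by (cases "0 < t") (auto simp: dyadic_step_eq)
  qed
  also have "\<dots> = esum (\<lambda>k. c k * ennreal (2 powr k))" by (rule nn_integral_dyadic_step)
  also have "\<dots> = esum (\<lambda>k. ennreal (2 powr u) * epowr (dyadic_profile M p g k) u)"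
  proof (intro nn_integral_cong)
    fix k :: int
    have "c k * ennreal (2 powr k) = epowr (2 * dyadic_profile M p g k) u"
      by (simp add: c_def ennreal_divide_times)
    then show "c k * ennreal (2 powr k) = ennreal (2 powr u) * epowr (dyadic_profile M p g k) u"
      using u epowr_ennreal[of 2 u] by (simp add: epowr_mult)
  qed
  finally show ?thesis by (simp add: nn_integral_cmult)
qed

text \<open>The step function now lies below the integrand, so \<open>1 / t\<close> is taken at the
  right end, which is twice the interval length; this accounts for the additional 2 in the
  constant.\<close>

lemma lorentz_integral_lower:
  assumes u: "0 < u"
  shows "esum (\<lambda>k. epowr (dyadic_profile M p g k) u)
    \<le> ennreal (2 * 2 powr u) * (\<integral>\<^sup>+ t \<in> {0<..}. epowr (h t) u / ennreal t \<partial>lborel)"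
proof -
  define c where "c k = epowr (ennreal (1 / 2) * dyadic_profile M p g (k + 1)) u / ennreal (2 powr (real_of_int k + 1))"
    for k :: int
  have "esum (\<lambda>k. epowr (dyadic_profile M p g k) u) = esum (\<lambda>k. epowr (dyadic_profile M p g (k + 1)) u)"
    by (rule esum_bij[symmetric, of "\<lambda>k. k + 1"]) (auto intro: bij_plus_right)
  also have "\<dots> = esum (\<lambda>k. ennreal (2 * 2 powr u) * (c k * ennreal (2 powr k)))"
  proof (intro nn_integral_cong)
    fix k :: int
    have "ennreal (2 * 2 powr u) * (c k * ennreal (2 powr k)) =
        ennreal (2 powr u) * (c k * ennreal (2 powr (real_of_int k + 1)))"
      by (simp add: powr_add ennreal_mult mult_ac)
    also have "c k * ennreal (2 powr (real_of_int k + 1)) =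
        epowr (ennreal (1 / 2) * dyadic_profile M p g (k + 1)) u"
      by (simp add: c_def ennreal_divide_times)
    also have "ennreal (2 powr u) * \<dots> =
        ennreal (2 powr u) * ennreal ((1 / 2) powr u) * epowr (dyadic_profile M p g (k + 1)) u"
      using u epowr_ennreal[of "1 / 2" u] by (simp only: epowr_mult mult.assoc)
    also have "ennreal (2 powr u) * ennreal ((1 / 2) powr u) = 1"
      by (simp add: ennreal_mult[symmetric] powr_mult[symmetric])
    finally show "epowr (dyadic_profile M p g (k + 1)) u = ennreal (2 * 2 powr u) * (c k * ennreal (2 powr k))"
      by simp
  qed
  also have "\<dots> = ennreal (2 * 2 powr u) *
      (\<integral>\<^sup>+t. esum (\<lambda>k::int. c k * indicator {2 powr k<..2 powr (real_of_int k + 1)} t) \<partial>lborel)"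
    unfolding nn_integral_dyadic_step by (rule nn_integral_cmult) auto
  also have "\<dots> \<le> ennreal (2 * 2 powr u) * (\<integral>\<^sup>+ t \<in> {0<..}. epowr (h t) u / ennreal t \<partial>lborel)"
  proof (intro mult_left_mono nn_integral_mono)
    fix t :: real
    have "c (dyadic_level t) \<le> epowr (h t) u / ennreal t" if t: "0 < t"
    proof -
      have "ennreal t \<le> ennreal (2 powr (real_of_int (dyadic_level t) + 1))"
        using dyadic_level_iff[OF t, of "dyadic_level t"] by (intro ennreal_leI) auto
      then show ?thesis
        unfolding c_def divide_ennreal_def using u t dyadic_profile_lower[OF t]
        by (intro mult_mono epowr_mono) (auto simp: ennreal_inverse_antimono)
    qed
    then show "esum (\<lambda>k::int. c k * indicator {2 powr k<..2 powr (real_of_int k + 1)} t) \<le>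
        epowr (h t) u / ennreal t * indicator {0<..} t"
    proof (cases "0 < t")
      case False
      then have "t \<notin> {2 powr k<..2 powr (real_of_int k + 1)}" for k :: int
        using powr_gt_zero[of 2 "real_of_int k"] by (auto simp del: powr_gt_zero)
      then have "esum (\<lambda>k::int. c k * indicator {2 powr k<..2 powr (real_of_int k + 1)} t) = esum (\<lambda>k::int. 0)"
        by (intro nn_integral_cong) simp
      then show ?thesis by simp
    qed (auto simp: dyadic_step_eq)
  qed auto
  finally show ?thesis .
qed

end

text \<open>\<open>C\<close> does not depend on \<open>g\<close>, so boundedness of the maximal
  operator can be passed to the profiles and back.\<close>

lemma lorentz_norm_equiv_lnorm:
  assumes p: "0 < p" and q: "0 < q"
  obtains C where "0 < C"
    "\<And>g. lorentz_norm M p q g \<le> ennreal C * lnorm q (dyadic_profile M p g)"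
    "\<And>g. lnorm q (dyadic_profile M p g) \<le> ennreal C * lorentz_norm M p q g"
  using q
proof (cases rule: ennreal_exponent_cases)
  case (fin u)
  define J where "J g = (\<integral>\<^sup>+ t \<in> {0<..}. epowr (ennreal t * epowr (distrib_fun M g t) (1 / p)) u / ennreal t \<partial>lborel)" for g
  have norm: "lorentz_norm M p q g = ennreal (p powr (1 / u)) * epowr (J g) (1 / u)" for g
    using fin by (simp add: lorentz_norm_def J_def)
  \<comment> \<open>Apart from the normalising factor \<open>p powr (1 / u)\<close>, the entries are
    the \<open>u\<close>-th roots of the constants in \<open>lorentz_integral_upper\<close> and
    \<open>lorentz_integral_lower\<close>.\<close>
  define C where "C = max (2 * p powr (1 / u)) ((2 * 2 powr u) powr (1 / u) / p powr (1 / u))"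
  have C: "2 * p powr (1 / u) \<le> C" "(2 * 2 powr u) powr (1 / u) / p powr (1 / u) \<le> C" "0 < C"
    using p by (auto simp: C_def less_max_iff_disj)
  show ?thesis
  proof (rule that[OF C(3)])
    fix g
    let ?S = "esum (\<lambda>k. epowr (dyadic_profile M p g k) u)"
    have S: "lnorm q (dyadic_profile M p g) = epowr ?S (1 / u)" using fin by (simp add: lnorm_ennreal)
    have "epowr (J g) (1 / u) \<le> epowr (ennreal (2 powr u) * ?S) (1 / u)"
      unfolding J_def using fin by (intro epowr_mono lorentz_integral_upper[OF p]) auto
    also have "\<dots> = ennreal 2 * epowr ?S (1 / u)"
      using fin by (simp add: epowr_mult epowr_ennreal powr_powr)
    finally have "lorentz_norm M p q g \<le> ennreal (p powr (1 / u)) * (ennreal 2 * epowr ?S (1 / u))"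
      unfolding norm by (intro mult_left_mono) auto
    also have "\<dots> = ennreal (2 * p powr (1 / u)) * epowr ?S (1 / u)"
      by (simp add: ennreal_mult mult_ac)
    also have "\<dots> \<le> ennreal C * epowr ?S (1 / u)" using C by (intro mult_right_mono ennreal_leI) auto
    finally show "lorentz_norm M p q g \<le> ennreal C * lnorm q (dyadic_profile M p g)" by (simp add: S)
    have "epowr ?S (1 / u) \<le> epowr (ennreal (2 * 2 powr u) * J g) (1 / u)"
      unfolding J_def using fin by (intro epowr_mono lorentz_integral_lower[OF p]) auto
    also have "\<dots> = ennreal ((2 * 2 powr u) powr (1 / u)) * epowr (J g) (1 / u)"
      using fin by (simp add: epowr_mult epowr_ennreal)
    also have "\<dots> = ennreal ((2 * 2 powr u) powr (1 / u) / p powr (1 / u)) * lorentz_norm M p q g"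
      using p by (simp add: norm mult.assoc[symmetric] ennreal_mult[symmetric])
    also have "\<dots> \<le> ennreal C * lorentz_norm M p q g" using C by (intro mult_right_mono ennreal_leI) auto
    finally show "lnorm q (dyadic_profile M p g) \<le> ennreal C * lorentz_norm M p q g" by (simp add: S)
  qed
next
  case inf
  have norm: "lorentz_norm M p q g = (SUP t\<in>{0<..}. ennreal t * epowr (distrib_fun M g t) (1 / p))" for g
    using inf by (simp add: lorentz_norm_def)
  show ?thesis
  proof (rule that[of 2])
    fix g
    show "lorentz_norm M p q g \<le> ennreal 2 * lnorm q (dyadic_profile M p g)"
      unfolding norm
    proof (rule SUP_least)
      fix t :: real assume "t \<in> {0<..}"
      then have "ennreal t * epowr (distrib_fun M g t) (1 / p) \<le> 2 * dyadic_profile M p g (dyadic_level t)"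
        using dyadic_profile_upper[OF p] by simp
      also have "\<dots> \<le> 2 * lnorm q (dyadic_profile M p g)" by (intro mult_left_mono le_lnorm q) auto
      finally show "ennreal t * epowr (distrib_fun M g t) (1 / p) \<le> ennreal 2 * lnorm q (dyadic_profile M p g)"
        by simp
    qed
    \<comment> \<open>The dyadic samples are among the values whose supremum is the Lorentz
      norm.\<close>
    have "lnorm q (dyadic_profile M p g) \<le> 1 * lorentz_norm M p q g"
      unfolding norm using inf
      by (auto simp: lnorm_top dyadic_profile_def intro!: SUP_least SUP_upper)
    also have "\<dots> \<le> ennreal 2 * lorentz_norm M p q g" by (intro mult_right_mono) auto
    finally show "lnorm q (dyadic_profile M p g) \<le> ennreal 2 * lorentz_norm M p q g" .
  qed auto
qed

section \<open>The maximal function\<close>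

text \<open>Measurable hulls of equal outer measure reduce this to subadditivity of the measure. It
  serves for superlevel sets of the maximal function, which enter without a measurability
  proof.\<close>

lemma outer_measure_of_Un:
  assumes "A \<subseteq> space M" "B \<subseteq> space M"
  shows "outer_measure_of M (A \<union> B) \<le> outer_measure_of M A + outer_measure_of M B"
proof -
  obtain E F where EF: "E \<in> sets M" "A \<subseteq> E" "outer_measure_of M A = emeasure M E"
    "F \<in> sets M" "B \<subseteq> F" "outer_measure_of M B = emeasure M F"
    using outer_measure_of_attain[OF assms(1)] outer_measure_of_attain[OF assms(2)] by blast
  have "outer_measure_of M (A \<union> B) \<le> outer_measure_of M (E \<union> F)"
    using EF by (intro outer_measure_of_mono) auto
  also have "\<dots> = emeasure M (E \<union> F)" using EF by simp
  also have "\<dots> \<le> emeasure M E + emeasure M F" using EF by (intro emeasure_subadditive)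
  finally show ?thesis using EF by simp
qed

text \<open>Where \<open>g\<close> exceeds \<open>2 powr (k + 1)\<close>, one of \<open>g1\<close>
  and \<open>g2\<close> exceeds \<open>2 powr k\<close>; this gives the shifted index and the factor
  2. The bound \<open>1 \<le> p\<close> makes the power \<open>1 / p\<close> subadditive.\<close>

lemma dyadic_profile_subadditive:
  assumes p: "1 \<le> p" and g: "\<And>x. x \<in> space M \<Longrightarrow> g x \<le> g1 x + g2 x"
  shows "dyadic_profile M p g (k + 1) \<le> 2 * dyadic_profile M p g1 k + 2 * dyadic_profile M p g2 k"
proof -
  have "{x \<in> space M. ennreal (2 powr (real_of_int k + 1)) < g x} \<subseteq>
    {x \<in> space M. ennreal (2 powr k) < g1 x} \<union> {x \<in> space M. ennreal (2 powr k) < g2 x}"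
  proof (rule subsetI, rule ccontr)
    fix x
    assume "x \<in> {x \<in> space M. ennreal (2 powr (real_of_int k + 1)) < g x}"
      "x \<notin> {x \<in> space M. ennreal (2 powr k) < g1 x} \<union> {x \<in> space M. ennreal (2 powr k) < g2 x}"
    then have x: "x \<in> space M" "ennreal (2 powr (real_of_int k + 1)) < g x"
      "g1 x \<le> ennreal (2 powr k)" "g2 x \<le> ennreal (2 powr k)"
      by (auto simp: not_less)
    have "g x \<le> ennreal (2 powr k) + ennreal (2 powr k)"
      using g[OF x(1)] add_mono[OF x(3,4)] by (rule order_trans)
    also have "\<dots> = ennreal (2 powr (real_of_int k + 1))"
      by (simp add: ennreal_plus[symmetric] powr_add del: ennreal_plus)
    finally show False using x(2) by simp
  qed
  then have "distrib_fun M g (2 powr (real_of_int k + 1)) \<le>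
      distrib_fun M g1 (2 powr k) + distrib_fun M g2 (2 powr k)"
    unfolding distrib_fun_def
    by (intro order_trans[OF outer_measure_of_mono outer_measure_of_Un]) auto
  then have "epowr (distrib_fun M g (2 powr (real_of_int k + 1))) (1 / p) \<le>
      epowr (distrib_fun M g1 (2 powr k)) (1 / p) + epowr (distrib_fun M g2 (2 powr k)) (1 / p)"
    using p by (intro order_trans[OF epowr_mono epowr_add_le]) auto
  then have "dyadic_profile M p g (k + 1) \<le> ennreal (2 * 2 powr k) *
      (epowr (distrib_fun M g1 (2 powr k)) (1 / p) + epowr (distrib_fun M g2 (2 powr k)) (1 / p))"
    by (auto simp: dyadic_profile_def powr_add mult.commute[of 2] intro!: mult_left_mono)
  then show ?thesis
    by (simp add: dyadic_profile_def ennreal_mult distrib_left mult.assoc)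
qed

text \<open>The hypothesis describes a profile after restriction to the levels in \<open>K\<close>:
  level \<open>j\<close> borrows from some \<open>k\<close> in \<open>K\<close> at or above it, with
  weight \<open>2 powr (j - k)\<close>. These weights form a geometric series in \<open>j\<close>,
  which for \<open>1 \<le> q\<close> costs at most a factor 2.\<close>

lemma lnorm_envelope:
  fixes c a :: "int \<Rightarrow> ennreal"
  assumes c: "\<And>j. c j = 0 \<or> (\<exists>k\<ge>j. k \<in> K \<and> c j \<le> ennreal (2 powr (real_of_int j - real_of_int k)) * a k)"
    and q: "1 \<le> q"
  shows "lnorm q c \<le> 2 * lnorm q (\<lambda>k. a k * indicator K k)"
proof -
  have q0: "0 < q" using q by (auto intro: less_le_trans[OF zero_less_one])
  then show ?thesis
  proof (cases rule: ennreal_exponent_cases)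
    case (fin u)
    then have u: "1 \<le> u" using q by simp
    define d where "d k = epowr (a k * indicator K k) u" for k
    \<comment> \<open>\<open>w j k\<close> is \<open>2 powr (j * u)\<close> for
      \<open>j \<le> k\<close> and 0 otherwise, written so as to fit
      \<open>geometric_sum_below\<close> with \<gamma> equal to 1.\<close>
    define w where "w j k = (if 2 powr (1 * real_of_int j) \<le> 2 powr k
      then ennreal ((2 powr (1 * real_of_int j)) powr u) else 0)" for j k :: int
    have "epowr (c j) u \<le> esum (\<lambda>k. w j k * (ennreal (2 powr (- u * k)) * d k))" for j
    proof (cases "c j = 0")
      case False
      then obtain k where k: "j \<le> k" "k \<in> K" "c j \<le> ennreal (2 powr (real_of_int j - real_of_int k)) * a k"
        using c[of j] by auto
      then have "epowr (c j) u \<le> epowr (ennreal (2 powr (real_of_int j - real_of_int k)) * a k) u"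
        using u by (intro epowr_mono) auto
      also have "\<dots> = ennreal (2 powr ((real_of_int j - real_of_int k) * u)) * d k"
        using k(2) u by (simp add: d_def epowr_mult epowr_ennreal powr_powr)
      also have "2 powr ((real_of_int j - real_of_int k) * u) = 2 powr (j * u) * 2 powr (- u * k)"
        by (subst powr_add[symmetric]) (simp add: algebra_simps)
      also have "ennreal (2 powr (j * u) * 2 powr (- u * k)) = w j k * ennreal (2 powr (- u * k))"
        using k(1) by (simp add: w_def powr_powr ennreal_mult)
      also have "\<dots> * d k = w j k * (ennreal (2 powr (- u * k)) * d k)"
        by (rule mult.assoc)
      also have "\<dots> \<le> esum (\<lambda>k. w j k * (ennreal (2 powr (- u * k)) * d k))" by (rule le_esum)
      finally show ?thesis .
    qed simp
    then have "esum (\<lambda>j. epowr (c j) u) \<le> esum (\<lambda>j. esum (\<lambda>k. w j k * (ennreal (2 powr (- u * k)) * d k)))"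
      by (intro nn_integral_mono)
    also have "\<dots> = esum (\<lambda>k. esum (\<lambda>j. w j k) * (ennreal (2 powr (- u * k)) * d k))"
      by (subst esum_swap) (simp add: nn_integral_multc)
    also have "\<dots> \<le> esum (\<lambda>k. 2 * d k)"
    proof (intro nn_integral_mono)
      fix k :: int
      have "2 powr - u \<le> 2 powr (- 1 :: real)" using u by (intro powr_mono) auto
      then have half: "2 powr - u \<le> (1 / 2 :: real)" by (simp add: powr_minus)
      have "esum (\<lambda>j. w j k) \<le> ennreal ((2 powr k) powr u / (1 - 2 powr - (1 * u)))"
        unfolding w_def using u by (intro geometric_sum_below) auto
      also have "\<dots> \<le> ennreal (2 * 2 powr (u * k))"
      proof (rule ennreal_leI)
        have "2 powr (u * k) * 1 \<le> 2 powr (u * k) * (2 * (1 - 2 powr - u))"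
          using half by (intro mult_left_mono) auto
        then show "(2 powr k) powr u / (1 - 2 powr - (1 * u)) \<le> 2 * 2 powr (u * k)"
          using half by (simp add: powr_powr pos_divide_le_eq mult_ac)
      qed
      finally have "esum (\<lambda>j. w j k) * (ennreal (2 powr (- u * k)) * d k) \<le>
          ennreal (2 * 2 powr (u * k)) * (ennreal (2 powr (- u * k)) * d k)"
        by (intro mult_right_mono) auto
      also have "\<dots> = ennreal (2 * 2 powr (u * k) * 2 powr (- u * k)) * d k"
        by (simp add: ennreal_mult mult.assoc)
      also have "2 * 2 powr (u * k) * 2 powr (- u * k) = (2::real)"
        by (simp add: powr_minus)
      finally show "esum (\<lambda>j. w j k) * (ennreal (2 powr (- u * k)) * d k) \<le> 2 * d k" by simp
    qed
    \<comment> \<open>Since \<open>2 \<le> 2 powr u\<close>, the constant can be put under the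
      \<open>u\<close>-th power and comes out of the norm as 2.\<close>
    also have "\<dots> \<le> esum (\<lambda>k. epowr 2 u * d k)"
    proof (intro nn_integral_mono mult_right_mono)
      have "2 powr 1 \<le> 2 powr u" using u by (intro powr_mono) auto
      then have "ennreal 2 \<le> ennreal (2 powr u)" by (intro ennreal_leI) simp
      then show "2 \<le> epowr 2 u" using epowr_ennreal[of 2 u] by simp
    qed auto
    finally show ?thesis
      using fin by (simp add: lnorm_le_iff epowr_mult nn_integral_cmult)
        (simp add: lnorm_ennreal epowr_epowr_inverse d_def)
  next
    case inf
    have "c j \<le> 1 * lnorm q (\<lambda>k. a k * indicator K k)" for j
    proof (cases "c j = 0")
      case False
      then obtain k where k: "j \<le> k" "k \<in> K" "c j \<le> ennreal (2 powr (real_of_int j - real_of_int k)) * a k"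
        using c[of j] by auto
      have "ennreal (2 powr (real_of_int j - real_of_int k)) \<le> 1"
        using k powr_mono[of "real_of_int j - real_of_int k" 0 2] by simp
      then have "c j \<le> 1 * (a k * indicator K k)"
        using k(2) order_trans[OF k(3) mult_right_mono[of _ 1 "a k"]] by simp
      also have "\<dots> \<le> 1 * lnorm q (\<lambda>k. a k * indicator K k)"
        using le_lnorm[OF q0, of "\<lambda>k. a k * indicator K k" k] by simp
      finally show ?thesis .
    qed simp
    then have "lnorm q c \<le> 1 * lnorm q (\<lambda>k. a k * indicator K k)"
      using inf by (auto simp: lnorm_top intro!: SUP_least)
    also have "\<dots> \<le> 2 * lnorm q (\<lambda>k. a k * indicator K k)" by (intro mult_right_mono) auto
    finally show ?thesis .
  qed
qed

text \<open>\<open>K\<close> is an arbitrary set of levels because it is chosen by the size of the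
  profile, which need not be monotone in the level. Where \<open>f\<close> vanishes, the value is 0
  for every \<open>K\<close>.\<close>

definition restrict_levels :: "int set \<Rightarrow> ('a \<Rightarrow> real) \<Rightarrow> 'a \<Rightarrow> real" where
  "restrict_levels K f x = (if dyadic_level \<bar>f x\<bar> \<in> K then f x else 0)"

lemma restrict_levels_measurable:
  assumes [measurable]: "f \<in> borel_measurable M"
  shows "restrict_levels K f \<in> borel_measurable M"
proof -
  have [measurable]: "(\<lambda>x. dyadic_level \<bar>f x\<bar>) \<in> measurable M (count_space UNIV)"
    unfolding dyadic_level_def by measurable
  have "{x \<in> space M. dyadic_level \<bar>f x\<bar> \<in> K} \<in> sets M" by measurable
  then show ?thesis
    unfolding restrict_levels_def[abs_def] by (intro measurable_If) auto
qed

text \<open>Let \<open>k\<close> be the least element of \<open>K\<close> with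
  \<open>j \<le> k\<close>. A restricted value above \<open>2 powr j\<close> in modulus has its
  level in \<open>K\<close> and at least \<open>j\<close>, hence at least \<open>k\<close>, so
  \<open>f\<close> exceeds \<open>2 powr k\<close> in modulus there. Without such a \<open>k\<close>
  there is no such value.\<close>

lemma dyadic_profile_restrict_levels:
  fixes M :: "'a measure" and f :: "'a \<Rightarrow> real" and K :: "int set"
  assumes p: "0 < p"
  defines "c \<equiv> dyadic_profile M p (\<lambda>x. ennreal \<bar>restrict_levels K f x\<bar>)"
    and "a \<equiv> dyadic_profile M p (\<lambda>x. ennreal \<bar>f x\<bar>)"
  shows "c j = 0 \<or> (\<exists>k\<ge>j. k \<in> K \<and> c j \<le> ennreal (2 powr (real_of_int j - real_of_int k)) * a k)"
proof -
  have level: "dyadic_level \<bar>f x\<bar> \<in> K \<and> j \<le> dyadic_level \<bar>f x\<bar> \<and> 2 powr dyadic_level \<bar>f x\<bar> < \<bar>f x\<bar>"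
    if "ennreal (2 powr j) < ennreal \<bar>restrict_levels K f x\<bar>" for x
  proof -
    have K: "dyadic_level \<bar>f x\<bar> \<in> K" and less: "2 powr j < \<bar>f x\<bar>"
      using that by (auto simp: restrict_levels_def ennreal_less_iff split: if_splits)
    then have "0 < \<bar>f x\<bar>" using powr_gt_zero[of 2 "real_of_int j"] by linarith
    note l = dyadic_level_iff[OF this, of "dyadic_level \<bar>f x\<bar>", simplified]
    then have "2 powr j < 2 powr (real_of_int (dyadic_level \<bar>f x\<bar>) + 1)" using less by linarith
    then have "j \<le> dyadic_level \<bar>f x\<bar>" by simp
    with K l show ?thesis by simp
  qed
  show ?thesis
  proof (cases "\<exists>k. k \<in> K \<and> j \<le> k")
    case True
    \<comment> \<open>The distance to \<open>j\<close> is minimised, as the integers themselves are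
      not well-ordered.\<close>
    then obtain k where k: "k \<in> K" "j \<le> k"
      and least: "\<And>k'. k' \<in> K \<and> j \<le> k' \<Longrightarrow> nat (k - j) \<le> nat (k' - j)"
      using ex_has_least_nat[of "\<lambda>k. k \<in> K \<and> j \<le> k" _ "\<lambda>k. nat (k - j)"] by blast
    have min: "k \<le> k'" if "k' \<in> K" "j \<le> k'" for k'
      using least[of k'] that k by auto
    have "2 powr k < \<bar>f x\<bar>" if "ennreal (2 powr j) < ennreal \<bar>restrict_levels K f x\<bar>" for x
    proof -
      have "2 powr k \<le> 2 powr dyadic_level \<bar>f x\<bar>" using level[OF that] min by auto
      then show ?thesis using level[OF that] by linarith
    qed
    then have "distrib_fun M (\<lambda>x. ennreal \<bar>restrict_levels K f x\<bar>) (2 powr j) \<le>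
        distrib_fun M (\<lambda>x. ennreal \<bar>f x\<bar>) (2 powr k)"
      unfolding distrib_fun_def by (intro outer_measure_of_mono) (auto simp: ennreal_less_iff)
    then have "c j \<le> ennreal (2 powr j) * epowr (distrib_fun M (\<lambda>x. ennreal \<bar>f x\<bar>) (2 powr k)) (1 / p)"
      unfolding c_def dyadic_profile_def using p by (intro mult_left_mono epowr_mono) auto
    also have "\<dots> = ennreal (2 powr (real_of_int j - real_of_int k)) * a k"
      by (simp add: a_def dyadic_profile_def mult.assoc[symmetric] ennreal_mult[symmetric] powr_add[symmetric])
    finally show ?thesis using k by blast
  next
    case False
    then have "{x \<in> space M. ennreal (2 powr j) < ennreal \<bar>restrict_levels K f x\<bar>} = {}"
      using level by blast
    then have "c j = 0" by (simp only: c_def dyadic_profile_def distrib_fun_def) simp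
    then show ?thesis ..
  qed
qed

text \<open>Each ball average splits into two; \<open>sets M = sets borel\<close> makes the balls
  measurable, as additivity of the integral requires.\<close>

lemma maxfun_c_subadditive:
  assumes sets: "sets M = sets borel"
    and [measurable]: "f1 \<in> borel_measurable M" "f2 \<in> borel_measurable M"
    and f: "\<And>x. \<bar>f x\<bar> \<le> \<bar>f1 x\<bar> + \<bar>f2 x\<bar>"
  shows "maxfun_c M f x \<le> maxfun_c M f1 x + maxfun_c M f2 x"
  unfolding maxfun_c_def
proof (rule SUP_least)
  let ?S = "{s. 0 < s \<and> emeasure M (ball x s) \<noteq> 0 \<and> emeasure M (ball x s) \<noteq> \<infinity>}"
  fix s assume s: "s \<in> ?S"
  have [measurable]: "ball x s \<in> sets M" by (simp add: sets)
  have "(\<integral>\<^sup>+ y \<in> ball x s. ennreal \<bar>f y\<bar> \<partial>M) \<le>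
      (\<integral>\<^sup>+ y. ennreal \<bar>f1 y\<bar> * indicator (ball x s) y + ennreal \<bar>f2 y\<bar> * indicator (ball x s) y \<partial>M)"
    using f by (intro nn_integral_mono)
      (auto simp: ennreal_plus[symmetric] ennreal_leI simp del: ennreal_plus split: split_indicator)
  also have "\<dots> = (\<integral>\<^sup>+ y \<in> ball x s. ennreal \<bar>f1 y\<bar> \<partial>M) + (\<integral>\<^sup>+ y \<in> ball x s. ennreal \<bar>f2 y\<bar> \<partial>M)"
    by (rule nn_integral_add) auto
  finally have "(\<integral>\<^sup>+ y \<in> ball x s. ennreal \<bar>f y\<bar> \<partial>M) / emeasure M (ball x s) \<le>
      (\<integral>\<^sup>+ y \<in> ball x s. ennreal \<bar>f1 y\<bar> \<partial>M) / emeasure M (ball x s) +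
      (\<integral>\<^sup>+ y \<in> ball x s. ennreal \<bar>f2 y\<bar> \<partial>M) / emeasure M (ball x s)"
    by (simp add: add_divide_distrib_ennreal[symmetric] divide_right_mono_ennreal)
  also have "\<dots> \<le> (SUP s\<in>?S. (\<integral>\<^sup>+ y \<in> ball x s. ennreal \<bar>f1 y\<bar> \<partial>M) / emeasure M (ball x s)) +
      (SUP s\<in>?S. (\<integral>\<^sup>+ y \<in> ball x s. ennreal \<bar>f2 y\<bar> \<partial>M) / emeasure M (ball x s))"
    using s by (intro add_mono SUP_upper) auto
  finally show "(\<integral>\<^sup>+ y \<in> ball x s. ennreal \<bar>f y\<bar> \<partial>M) / emeasure M (ball x s) \<le> \<dots>" .
qed

text \<open>The finiteness condition on the source norm disappears: with a positive constant the
  inequality is trivial when that norm is infinite. Restrictions of \<open>f\<close> can then be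
  inserted without further checks.\<close>

lemma maxfun_bounded_iff_dyadic:
  assumes "0 < p" "0 < q" "0 < r"
  shows "maxfun_bounded M p q r \<longleftrightarrow> (\<exists>C>0. \<forall>f\<in>borel_measurable M.
    lnorm r (dyadic_profile M p (maxfun_c M f)) \<le> ennreal C * lnorm q (dyadic_profile M p (\<lambda>x. ennreal \<bar>f x\<bar>)))"
    (is "_ \<longleftrightarrow> ?dyadic")
proof -
  obtain A where A: "0 < A"
    "\<And>g. lorentz_norm M p q g \<le> ennreal A * lnorm q (dyadic_profile M p g)"
    "\<And>g. lnorm q (dyadic_profile M p g) \<le> ennreal A * lorentz_norm M p q g"
    using lorentz_norm_equiv_lnorm[OF assms(1,2)] by blast
  obtain B where B: "0 < B"
    "\<And>g. lorentz_norm M p r g \<le> ennreal B * lnorm r (dyadic_profile M p g)"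
    "\<And>g. lnorm r (dyadic_profile M p g) \<le> ennreal B * lorentz_norm M p r g"
    using lorentz_norm_equiv_lnorm[OF assms(1,3)] by blast
  show ?thesis
  proof
    assume "maxfun_bounded M p q r"
    then obtain C where C: "0 \<le> C" "\<And>f. f \<in> borel_measurable M \<Longrightarrow>
        lorentz_norm M p q (\<lambda>x. ennreal \<bar>f x\<bar>) < \<infinity> \<Longrightarrow>
        lorentz_norm M p r (maxfun_c M f) \<le> ennreal C * lorentz_norm M p q (\<lambda>x. ennreal \<bar>f x\<bar>)"
      unfolding maxfun_bounded_def by blast
    have "lnorm r (dyadic_profile M p (maxfun_c M f)) \<le>
        ennreal (B * (C + 1) * A) * lnorm q (dyadic_profile M p (\<lambda>x. ennreal \<bar>f x\<bar>))"
      if f: "f \<in> borel_measurable M" for f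
    proof -
      let ?N = "lorentz_norm M p q (\<lambda>x. ennreal \<bar>f x\<bar>)"
      \<comment> \<open>\<open>C\<close> may be 0, and 0 times infinity is 0, so
        \<open>C + 1\<close> is taken to cover an infinite norm.\<close>
      have "lorentz_norm M p r (maxfun_c M f) \<le> ennreal (C + 1) * ?N"
      proof (cases "?N < \<infinity>")
        case True
        have "lorentz_norm M p r (maxfun_c M f) \<le> ennreal C * ?N" using C f True by blast
        also have "\<dots> \<le> ennreal (C + 1) * ?N" by (intro mult_right_mono ennreal_leI) auto
        finally show ?thesis .
      next
        case False
        then have "?N = top" by (simp add: less_top[symmetric])
        then show ?thesis using C by (simp add: ennreal_mult_top)
      qed
      then have "lnorm r (dyadic_profile M p (maxfun_c M f)) \<le> ennreal B * (ennreal (C + 1) * ?N)"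
        by (intro order_trans[OF B(3)] mult_left_mono) auto
      also have "\<dots> \<le> ennreal B * (ennreal (C + 1) *
          (ennreal A * lnorm q (dyadic_profile M p (\<lambda>x. ennreal \<bar>f x\<bar>))))"
        by (intro mult_left_mono A) auto
      finally show ?thesis using A B C by (simp add: ennreal_mult mult.assoc del: ennreal_plus)
    qed
    moreover have "0 < B * (C + 1) * A" using A B C by simp
    ultimately show ?dyadic by blast
  next
    assume ?dyadic
    then obtain C where C: "0 < C" "\<And>f. f \<in> borel_measurable M \<Longrightarrow>
        lnorm r (dyadic_profile M p (maxfun_c M f)) \<le>
          ennreal C * lnorm q (dyadic_profile M p (\<lambda>x. ennreal \<bar>f x\<bar>))"
      by blast
    have "lorentz_norm M p r (maxfun_c M f) \<le>
        ennreal (B * C * A) * lorentz_norm M p q (\<lambda>x. ennreal \<bar>f x\<bar>)"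
      if f: "f \<in> borel_measurable M" for f
    proof -
      have "lorentz_norm M p r (maxfun_c M f) \<le>
          ennreal B * (ennreal C * lnorm q (dyadic_profile M p (\<lambda>x. ennreal \<bar>f x\<bar>)))"
        by (intro order_trans[OF B(2)] mult_left_mono C f) auto
      also have "\<dots> \<le> ennreal B * (ennreal C * (ennreal A * lorentz_norm M p q (\<lambda>x. ennreal \<bar>f x\<bar>)))"
        by (intro mult_left_mono A) auto
      finally show ?thesis using A B C by (simp add: ennreal_mult mult.assoc)
    qed
    moreover have "0 \<le> B * C * A" using A B C by simp
    ultimately show "maxfun_bounded M p q r" unfolding maxfun_bounded_def by blast
  qed
qed

text \<open>By the nesting of the sequence quasinorms a smaller source exponent enlarges the
  right-hand side and a larger target exponent reduces the left-hand side.\<close>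

lemma maxfun_bounded_mono:
  assumes "maxfun_bounded M p q r" "0 < p" "0 < q'" "q' \<le> q" "0 < r" "r \<le> r'"
  shows "maxfun_bounded M p q' r'"
proof -
  have pos: "0 < q" "0 < r'" using assms by (auto intro: less_le_trans)
  obtain C where C: "0 < C" "\<And>f. f \<in> borel_measurable M \<Longrightarrow>
      lnorm r (dyadic_profile M p (maxfun_c M f)) \<le>
        ennreal C * lnorm q (dyadic_profile M p (\<lambda>x. ennreal \<bar>f x\<bar>))"
    using assms(1) unfolding maxfun_bounded_iff_dyadic[OF assms(2) pos(1) assms(5)] by blast
  have "lnorm r' (dyadic_profile M p (maxfun_c M f)) \<le>
      ennreal C * lnorm q' (dyadic_profile M p (\<lambda>x. ennreal \<bar>f x\<bar>))" if "f \<in> borel_measurable M" for f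
  proof -
    have "lnorm r' (dyadic_profile M p (maxfun_c M f)) \<le> lnorm r (dyadic_profile M p (maxfun_c M f))"
      using assms by (intro lnorm_antimono)
    also have "\<dots> \<le> ennreal C * lnorm q (dyadic_profile M p (\<lambda>x. ennreal \<bar>f x\<bar>))" by (rule C(2)[OF that])
    also have "\<dots> \<le> ennreal C * lnorm q' (dyadic_profile M p (\<lambda>x. ennreal \<bar>f x\<bar>))"
      using assms by (intro mult_left_mono lnorm_antimono) auto
    finally show ?thesis .
  qed
  then show ?thesis
    using C(1) unfolding maxfun_bounded_iff_dyadic[OF assms(2,3) pos(2)] by blast
qed

section \<open>Weighted harmonic means of extended exponents\<close>

lemma le_harmonic_mean:
  fixes m a b :: ennreal
  assumes "0 < \<theta>" "\<theta> < 1" "m \<le> a" "m \<le> b"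
  shows "m \<le> inverse (ennreal (1 - \<theta>) / a + ennreal \<theta> / b)"
proof -
  have "ennreal (1 - \<theta>) / a + ennreal \<theta> / b \<le> ennreal (1 - \<theta>) * inverse m + ennreal \<theta> * inverse m"
    unfolding divide_ennreal_def using assms
    by (intro add_mono mult_left_mono ennreal_inverse_antimono) auto
  also have "\<dots> = inverse m"
    using assms by (simp add: distrib_right[symmetric] ennreal_plus[symmetric] del: ennreal_plus)
  finally show ?thesis by (auto dest: ennreal_inverse_antimono)
qed

lemma harmonic_mean_le:
  fixes m a b :: ennreal
  assumes "0 < \<theta>" "\<theta> < 1" "a \<le> m" "b \<le> m"
  shows "inverse (ennreal (1 - \<theta>) / a + ennreal \<theta> / b) \<le> m"
proof -
  have "inverse m = ennreal (1 - \<theta>) * inverse m + ennreal \<theta> * inverse m"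
    using assms by (simp add: distrib_right[symmetric] ennreal_plus[symmetric] del: ennreal_plus)
  also have "\<dots> \<le> ennreal (1 - \<theta>) / a + ennreal \<theta> / b"
    unfolding divide_ennreal_def using assms
    by (intro add_mono mult_left_mono ennreal_inverse_antimono) auto
  finally show ?thesis by (auto dest: ennreal_inverse_antimono)
qed

text \<open>\<open>x\<close> is the reciprocal of \<open>q1\<close>, read as 0 for infinite
  \<open>q1\<close>. As \<open>u\<close> is finite and \<open>1 - \<theta>\<close> positive, the
  mean is a real number \<open>q\<close>, and \<open>1 / q\<close> lies strictly between
  \<open>x\<close> and \<open>1 / u\<close>.\<close>

lemma harmonic_mean_less:
  fixes q1 :: ennreal and u \<theta> :: real
  assumes \<theta>: "0 < \<theta>" "\<theta> < 1" and u: "0 < u" "ennreal u < q1"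
  defines "x \<equiv> enn2real (inverse q1)"
  obtains q where "inverse (ennreal (1 - \<theta>) / ennreal u + ennreal \<theta> / q1) = ennreal q"
    "u < q" "ennreal q < q1" "1 / q = (1 - \<theta>) / u + \<theta> * x" "x < 1 / u"
proof -
  define q where "q = 1 / ((1 - \<theta>) / u + \<theta> * x)"
  have x0: "0 \<le> x" by (simp add: x_def)
  have inv: "inverse q1 = ennreal x"
    using u by (cases q1) (auto simp: x_def inverse_ennreal ennreal_less_iff)
  have xu: "x < 1 / u"
    using u by (cases q1) (auto simp: x_def inverse_ennreal ennreal_less_iff field_simps)
  have pos: "0 < (1 - \<theta>) / u + \<theta> * x" using \<theta> u x0 by (intro add_pos_nonneg) auto
  then have q0: "0 < q" by (simp add: q_def)
  have "ennreal (1 - \<theta>) / ennreal u + ennreal \<theta> / q1 = ennreal ((1 - \<theta>) / u + \<theta> * x)"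
    using \<theta> u x0 unfolding divide_ennreal_def[of "ennreal \<theta>"] inv
    by (simp add: divide_ennreal ennreal_mult)
  then have eq: "inverse (ennreal (1 - \<theta>) / ennreal u + ennreal \<theta> / q1) = ennreal q"
    using pos by (simp add: inverse_ennreal q_def inverse_eq_divide)
  have q_inv: "1 / q = (1 - \<theta>) / u + \<theta> * x" by (simp add: q_def)
  have "\<theta> * x < \<theta> * (1 / u)" "(1 - \<theta>) * x < (1 - \<theta>) * (1 / u)"
    using xu \<theta> by (auto simp del: times_divide_eq_right intro!: mult_strict_left_mono)
  then have "1 / q < 1 / u" "x < 1 / q" unfolding q_inv by (auto simp: algebra_simps diff_divide_distrib)
  then have "u < q" "x * q < 1" using u q0 by (auto simp: field_simps)
  moreover have "ennreal q < q1"
  proof (cases q1)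
    case (real w)
    then have "0 < w" using u by (auto simp: ennreal_less_iff)
    then show ?thesis using \<open>x * q < 1\<close> real q0
      by (simp add: x_def inverse_ennreal ennreal_less_iff field_simps)
  qed simp
  ultimately show ?thesis using that eq q_inv xu by blast
qed

text \<open>\<open>marcinkiewicz_lnorm\<close> is applied to the profile of \<open>f\<close> and to
  that of its maximal function, shifted by one index. For each \<open>K\<close>, subadditivity
  splits the latter along the restrictions of \<open>f\<close> to \<open>K\<close> and to its
  complement; the endpoint bounds and \<open>lnorm_envelope\<close> control the two pieces.\<close>

lemma maxfun_bounded_interpolate:
  fixes M :: "'a::metric_space measure" and q1 r1 :: ennreal
  assumes sets: "sets M = sets borel" and p: "1 \<le> p"
    and q: "1 \<le> q0" "q0 < q" "ennreal q < q1" and r: "0 < r" "q0 \<le> r0" "q1 \<le> r1" and \<gamma>: "0 < \<gamma>"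
    and \<gamma>0: "r - r0 = \<gamma> * (q - q0) * (r0 / q0)"
    and \<gamma>1: "r * enn2real (inverse r1) - 1 = \<gamma> * (q * enn2real (inverse q1) - 1)"
    and bounded: "maxfun_bounded M p (ennreal q0) (ennreal r0)" "maxfun_bounded M p q1 r1"
  shows "maxfun_bounded M p (ennreal q) (ennreal r)"
proof -
  have p0: "0 < p" using p by simp
  have "ennreal q0 < ennreal q" using q by (simp add: ennreal_less_iff)
  then have q1: "1 \<le> q1" "0 < q1" "0 < r1" using q r
    by (auto intro: order_trans[of 1 "ennreal q0"] less_imp_le less_le_trans le_less_trans[OF zero_le])
  let ?b = "\<lambda>f. dyadic_profile M p (maxfun_c M f)" and ?a = "\<lambda>f. dyadic_profile M p (\<lambda>x. ennreal \<bar>f x\<bar>)"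
  obtain C0 where C0: "0 < C0" "\<And>f. f \<in> borel_measurable M \<Longrightarrow>
      lnorm (ennreal r0) (?b f) \<le> ennreal C0 * lnorm (ennreal q0) (?a f)"
    using bounded(1) maxfun_bounded_iff_dyadic[OF p0, of "ennreal q0" "ennreal r0" M] q r by auto
  obtain C1 where C1: "0 < C1" "\<And>f. f \<in> borel_measurable M \<Longrightarrow>
      lnorm r1 (?b f) \<le> ennreal C1 * lnorm q1 (?a f)"
    using bounded(2) maxfun_bounded_iff_dyadic[OF p0, of q1 r1 M] q1 by auto
  \<comment> \<open>One factor 2 comes from \<open>dyadic_profile_subadditive\<close>, the other
    from \<open>lnorm_envelope\<close>.\<close>
  define c where "c = 4 * max C0 C1"
  have c: "0 < c" using C0 by (simp add: c_def)
  obtain C where C: "0 < C" "\<forall>(a::int \<Rightarrow> ennreal) (b::int \<Rightarrow> ennreal). (\<forall>K. \<exists>b1 b2. (\<forall>k. b k \<le> b1 k + b2 k) \<and>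
        lnorm (ennreal r0) b1 \<le> ennreal c * lnorm (ennreal q0) (\<lambda>k. a k * indicator K k) \<and>
        lnorm r1 b2 \<le> ennreal c * lnorm q1 (\<lambda>k. a k * indicator (- K) k))
      \<longrightarrow> lnorm (ennreal r) b \<le> ennreal C * lnorm (ennreal q) a"
    using marcinkiewicz_lnorm[OF c less_le_trans[OF zero_less_one q(1)] q(2,3) r \<gamma> \<gamma>0 \<gamma>1, where 'i = int]
    by (elim exE conjE)
  have piece: "lnorm r' (\<lambda>k. 2 * ?b (restrict_levels K f) k) \<le> ennreal c * lnorm q' (\<lambda>k. ?a f k * indicator K k)"
    if f: "f \<in> borel_measurable M" and exps: "1 \<le> q'" "0 < r'" and "D \<le> max C0 C1" "0 < D"
      and D: "\<And>f. f \<in> borel_measurable M \<Longrightarrow> lnorm r' (?b f) \<le> ennreal D * lnorm q' (?a f)"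
    for f K q' r' D
  proof -
    have "lnorm r' (\<lambda>k. 2 * ?b (restrict_levels K f) k) = 2 * lnorm r' (?b (restrict_levels K f))"
      using exps by (simp add: lnorm_cmult)
    also have "\<dots> \<le> 2 * (ennreal D * lnorm q' (?a (restrict_levels K f)))"
      by (intro mult_left_mono D restrict_levels_measurable f) auto
    also have "\<dots> \<le> 2 * (ennreal D * (2 * lnorm q' (\<lambda>k. ?a f k * indicator K k)))"
      using exps by (intro mult_left_mono lnorm_envelope dyadic_profile_restrict_levels p0) auto
    also have "\<dots> = ennreal (4 * D) * lnorm q' (\<lambda>k. ?a f k * indicator K k)"
      using that by (simp add: ennreal_mult mult_ac)
    also have "\<dots> \<le> ennreal c * lnorm q' (\<lambda>k. ?a f k * indicator K k)"
      using that by (intro mult_right_mono ennreal_leI) (auto simp: c_def)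
    finally show ?thesis .
  qed
  have "lnorm (ennreal r) (?b f) \<le> ennreal C * lnorm (ennreal q) (?a f)"
    if f: "f \<in> borel_measurable M" for f
  proof -
    have "lnorm (ennreal r) (\<lambda>k. ?b f (k + 1)) \<le> ennreal C * lnorm (ennreal q) (?a f)"
    proof (rule C(2)[rule_format])
      fix K
      have sum: "?b f (k + 1) \<le> 2 * ?b (restrict_levels K f) k + 2 * ?b (restrict_levels (- K) f) k" for k
        by (intro dyadic_profile_subadditive p maxfun_c_subadditive sets restrict_levels_measurable f)
          (simp add: restrict_levels_def)
      have low: "lnorm (ennreal r0) (\<lambda>k. 2 * ?b (restrict_levels K f) k) \<le>
          ennreal c * lnorm (ennreal q0) (\<lambda>k. ?a f k * indicator K k)"
        using C0 q r by (intro piece[where D = C0] f) auto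
      have high: "lnorm r1 (\<lambda>k. 2 * ?b (restrict_levels (- K) f) k) \<le>
          ennreal c * lnorm q1 (\<lambda>k. ?a f k * indicator (- K) k)"
        using C1 q1 by (intro piece[where D = C1] f) auto
      show "\<exists>b1 b2. (\<forall>k. ?b f (k + 1) \<le> b1 k + b2 k) \<and>
          lnorm (ennreal r0) b1 \<le> ennreal c * lnorm (ennreal q0) (\<lambda>k. ?a f k * indicator K k) \<and>
          lnorm r1 b2 \<le> ennreal c * lnorm q1 (\<lambda>k. ?a f k * indicator (- K) k)"
        by (rule exI, rule exI, intro conjI allI) (rule sum low high)+
    qed
    \<comment> \<open>The shift forced by \<open>dyadic_profile_subadditive\<close> does not change
      the norm.\<close>
    also have "lnorm (ennreal r) (\<lambda>k. ?b f (k + 1)) = lnorm (ennreal r) (?b f)"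
      using lnorm_bij[of "\<lambda>k. k + 1" "ennreal r" "?b f"] by (simp add: bij_plus_right)
    finally show ?thesis .
  qed
  then show ?thesis
    using C(1) maxfun_bounded_iff_dyadic[OF p0, of "ennreal q" "ennreal r" M] q r by auto
qed

theorem theorem4p4p12:
  fixes M :: "'a::metric_space measure"
    and p :: real and q0 q1 r0 r1 :: ennreal and \<theta> :: real
  assumes "sets M = sets borel"
    and "1 \<le> p"
    and "1 \<le> q0" "1 \<le> q1" "1 \<le> r0" "1 \<le> r1"
    and "q0 \<le> q1" "q0 \<le> r0" "q1 \<le> r1"
    and "maxfun_bounded M p q0 r0"
    and "maxfun_bounded M p q1 r1"
    and "0 < \<theta>" "\<theta> < 1"
  shows "maxfun_bounded M p
           (inverse (ennreal (1 - \<theta>) / q0 + ennreal \<theta> / q1))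
           (inverse (ennreal (1 - \<theta>) / r0 + ennreal \<theta> / r1))"
proof -
  let ?q = "inverse (ennreal (1 - \<theta>) / q0 + ennreal \<theta> / q1)"
  let ?r = "inverse (ennreal (1 - \<theta>) / r0 + ennreal \<theta> / r1)"
  have pos: "0 < p" "0 < ?q" "0 < r0" "0 < r1"
    using assms le_harmonic_mean[of \<theta> 1 q0 q1] by (auto intro: less_le_trans[OF zero_less_one])
  consider "r1 \<le> r0" | "q0 = q1" "r0 < r1" | "q0 < q1" "r0 < r1"
    using \<open>q0 \<le> q1\<close> by (cases "r1 \<le> r0"; cases "q0 = q1") (auto simp: not_le order.strict_iff_order)
  then show ?thesis
  proof cases
    case 1
    \<comment> \<open>Here \<open>?q \<le> q1\<close> and \<open>r1 \<le> ?r\<close>, so the second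
      endpoint bound is enough.\<close>
    show ?thesis
      using assms pos 1
      by (intro maxfun_bounded_mono[OF assms(11)] harmonic_mean_le le_harmonic_mean) auto
  next
    case 2
    \<comment> \<open>Here \<open>?q \<le> q0\<close> and \<open>r0 \<le> ?r\<close>, so the first
      endpoint bound is enough.\<close>
    show ?thesis
      using assms pos 2
      by (intro maxfun_bounded_mono[OF assms(10)] harmonic_mean_le le_harmonic_mean) auto
  next
    case 3
    \<comment> \<open>\<open>q0\<close> and \<open>r0\<close> are finite, being strictly below
      \<open>q1\<close> and \<open>r1\<close>.\<close>
    then obtain u v where uv: "q0 = ennreal u" "r0 = ennreal v" "1 \<le> u" "u \<le> v" "1 \<le> v"
      using assms by (cases q0; cases r0) auto
    define x y where "x = enn2real (inverse q1)" and "y = enn2real (inverse r1)"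
    obtain q where q: "?q = ennreal q" "u < q" "ennreal q < q1" "1 / q = (1 - \<theta>) / u + \<theta> * x" "x < 1 / u"
      using harmonic_mean_less[OF assms(12,13), of u q1] 3 uv by (auto simp: x_def)
    obtain r where r: "?r = ennreal r" "v < r" "1 / r = (1 - \<theta>) / v + \<theta> * y" "y < 1 / v"
      using harmonic_mean_less[OF assms(12,13), of v r1] 3 uv by (auto simp: y_def)
    define X Y where "X = 1 / u - x" and "Y = 1 / v - y"
    have XY: "0 < X" "0 < Y" using q r by (auto simp: X_def Y_def)
    have qr: "0 < q" "0 < r" using q r uv by auto
    \<comment> \<open>The endpoint equations want \<gamma> to be the quotient of
      \<open>r * (1 / v) - 1\<close> by \<open>q * (1 / u) - 1\<close> and also of
      \<open>r * y - 1\<close> by \<open>q * x - 1\<close>. The formulas for \<open>1 / q\<close>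
      and \<open>1 / r\<close> reduce both to this value, since the common factors \<theta> and
      \<open>- (1 - \<theta>)\<close> cancel.\<close>
    define \<gamma> where "\<gamma> = r * Y / (q * X)"
    have \<gamma>: "0 < \<gamma>" using XY qr by (simp add: \<gamma>_def)
    have diff: "w * (1 / w') - 1 = w * (1 / w' - 1 / w)" if "0 < w" for w w' :: real
      using that by (simp add: right_diff_distrib)
    have "q * (1 / u) - 1 = \<theta> * (q * X)" "r * (1 / v) - 1 = \<theta> * (r * Y)"
      unfolding diff[OF qr(1)] diff[OF qr(2)] q(4) r(3) X_def Y_def by (simp_all add: algebra_simps diff_divide_distrib)
    then have "r * (1 / v) - 1 = \<gamma> * (q * (1 / u) - 1)" using XY qr by (simp add: \<gamma>_def)
    then have \<gamma>0: "r - v = \<gamma> * (q - u) * (v / u)" using uv by (simp add: field_simps)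
    have "q * x - 1 = q * (x - 1 / q)" "r * y - 1 = r * (y - 1 / r)"
      using qr by (simp_all add: right_diff_distrib)
    then have "q * x - 1 = - (1 - \<theta>) * (q * X)" "r * y - 1 = - (1 - \<theta>) * (r * Y)"
      unfolding q(4) r(3) X_def Y_def by (simp_all add: algebra_simps diff_divide_distrib)
    then have \<gamma>1: "r * y - 1 = \<gamma> * (q * x - 1)" using XY qr by (simp add: \<gamma>_def)
    show ?thesis
      unfolding q(1) r(1)
      by (rule maxfun_bounded_interpolate[OF assms(1,2) uv(3) q(2,3) qr(2) uv(4) assms(9) \<gamma> \<gamma>0])
        (use \<gamma>1 assms uv in \<open>auto simp: x_def y_def\<close>)
  qed
qed

end
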